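(* Let $K,L,A$ be as in the context and suppose there is an $A$-scaffold on $L$ of tolerance $\mathfrak{T}\ge1$ with shift parameters $b_1,\dots,b_n$ (elements $\lambda_t$, $\Psi_i$). Let $h\in\mathbb{Z}$, and let $\mathfrak{A}$, $b$, $d$, $w$, $\Phi^{(s)}$ be as in the context. Under the strong assumption $\mathfrak{T}\ge p^n+b-h$: (i) $\mathfrak{A}$ has $\mathfrak{O}_K$-basis $\{\Phi^{(s)}:s\in\mathbb{S}_{p^n}\}$; (ii) $\mathfrak{P}_L^h$ is free over $\mathfrak{A}$ if and only if $w(s)=d(s)$ for all $s\in\mathbb{S}_{p^n}$; moreover, if this condition holds, then $\mathfrak{P}_L^h=\mathfrak{A}\cdot\rho$ for any $\rho\in L$ with $v_L(\rho)=b$. Under the weak assumption $\mathfrak{T}\ge\max(b-h,1)$: (iii) $\Phi^{(s)}\in\mathfrak{A}$ for all $s\in\mathbb{S}_{p^n}$; (iv) if $w(s)=d(s)$ for all $s\in\mathbb{S}_{p^n}$, then $\mathfrak{A}$ has $\mathfrak{O}_K$-basis $\{\Phi^{(s)}:s\in\mathbb{S}_{p^n}\}$ and $\mathfrak{P}_L^h$ is free over $\mathfrak{A}$ with $\mathfrak{P}_L^h=\mathfrak{A}\cdot\lambda_b$.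
   Context: Let $K$ be a field complete with respect to a discrete valuation, with residue field $\kappa$ of characteristic $p>0$ ($\kappa$ need not be perfect; $K$ may have characteristic $0$ or $p$). Let $L/K$ be a totally ramified field extension of degree $p^n$; $v_K,v_L$ normalized valuations ($v_K(K^\times)=v_L(L^\times)=\mathbb{Z}$), $\mathfrak{O}_K,\mathfrak{O}_L$ valuation rings, $\mathfrak{P}_K,\mathfrak{P}_L$ maximal ideals. Let $A$ be a $K$-algebra with $\dim_K A=p^n$ acting $K$-linearly on $L$, written $\alpha\cdot x$. Let $\mathbb{S}_{p^n}=\{0,\dots,p^n-1\}$; write $s=\sum_{i=1}^n s_{(n-i)}p^{n-i}$ with digits $s_{(n-i)}\in\{0,\dots,p-1\}$, and $s\preceq t$ means $s_{(n-i)}\le t_{(n-i)}$ for all $i$. Given integers $b_1,\dots,b_n$ prime to $p$, put $\mathfrak{b}(s)=\sum_{i=1}^n s_{(n-i)}p^{n-i}b_i$; for $t\in\mathbb{Z}$ let $\mathfrak{a}(t)\in\mathbb{S}_{p^n}$ be the unique element with $\mathfrak{b}(\mathfrak{a}(t))\equiv-t\pmod{p^n}$ (digits $\mathfrak{a}(t)_{(n-i)}$). An $A$-scaffold on $L$ of tolerance $\mathfrak{T}\ge1$ (possibly $\infty$) with shift parameters $b_1,\dots,b_n$ consists of: (i) $\lambda_t\in L$ ($t\in\mathbb{Z}$) with $v_L(\lambda_t)=t$ and $\lambda_{t_1}\lambda_{t_2}^{-1}\in K$ whenever $t_1\equiv t_2\pmod{p^n}$; (ii) $\Psi_1,\dots,\Psi_n\in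 A$ with $\Psi_i\cdot1=0$ such that for each $i,t$ there is $u_{i,t}\in\mathfrak{O}_K^\times$ with $\Psi_i\cdot\lambda_t\equiv u_{i,t}\lambda_{t+p^{n-i}b_i}$ if $\mathfrak{a}(t)_{(n-i)}\ge1$ and $\Psi_i\cdot\lambda_t\equiv0$ if $\mathfrak{a}(t)_{(n-i)}=0$, modulo $\lambda_{t+p^{n-i}b_i}\mathfrak{P}_L^{\mathfrak{T}}$ (equalities if $\mathfrak{T}=\infty$). Put $\Psi^{(s)}=\Psi_n^{s_{(0)}}\Psi_{n-1}^{s_{(1)}}\cdots\Psi_1^{s_{(n-1)}}$. Fix a uniformizer $\pi$ of $K$ and $h\in\mathbb{Z}$. Let $\mathfrak{A}=\{\alpha\in A:\alpha\cdot\mathfrak{P}_L^h\subseteq\mathfrak{P}_L^h\}$. Let $\mathbb{S}_{p^n}(h)=\{t\in\mathbb{Z}:h\le t<h+p^n\}$ and let $b$ be the unique element of $\mathbb{S}_{p^n}(h)$ with $\mathfrak{a}(b)=p^n-1$. For $s\in\mathbb{S}_{p^n}$ let $d(s)=\lfloor(\mathfrak{b}(s)+b-h)/p^n\rfloor$, $w(s)=\min\{d(u)-d(u-s):u\in\mathbb{S}_{p^n},\,u\succeq s\}$, and $\Phi^{(s)}=\pi^{-w(s)}\Psi^{(s)}$. *)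

theory Defs
  imports Main "HOL-Library.Extended_Nat" "HOL-Computational_Algebra.Primes"
begin

section \<open>Valuations (value of v at 0 is irrelevant; 0 is treated separately)\<close>

definition discrete_valuation :: "('l::field \<Rightarrow> int) \<Rightarrow> bool" where
  "discrete_valuation v \<longleftrightarrow>
     (\<forall>x y. x \<noteq> 0 \<longrightarrow> y \<noteq> 0 \<longrightarrow> v (x * y) = v x + v y) \<and>
     (\<forall>x y. x \<noteq> 0 \<longrightarrow> y \<noteq> 0 \<longrightarrow> x + y \<noteq> 0 \<longrightarrow> min (v x) (v y) \<le> v (x + y)) \<and>
     (\<forall>k. \<exists>x. x \<noteq> 0 \<and> v x = k)"

definition subfield :: "'l::field set \<Rightarrow> bool" where
  "subfield K \<longleftrightarrow> 0 \<in> K \<and> 1 \<in> K \<and>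
     (\<forall>x\<in>K. \<forall>y\<in>K. x + y \<in> K \<and> x - y \<in> K \<and> x * y \<in> K) \<and>
     (\<forall>x\<in>K. inverse x \<in> K)"

definition complete_wrt :: "'l::field set \<Rightarrow> ('l \<Rightarrow> int) \<Rightarrow> bool" where
  "complete_wrt K v \<longleftrightarrow>
     (\<forall>f::nat \<Rightarrow> 'l. (\<forall>m. f m \<in> K) \<and>
        (\<forall>M. \<exists>N. \<forall>m\<ge>N. \<forall>k\<ge>N. f m = f k \<or> M \<le> v (f m - f k)) \<longrightarrow>
        (\<exists>x\<in>K. \<forall>M. \<exists>N. \<forall>m\<ge>N. f m = x \<or> M \<le> v (f m - x)))"

definition Pideal :: "('l::field \<Rightarrow> int) \<Rightarrow> int \<Rightarrow> 'l set" where
  "Pideal v h = {x. x = 0 \<or> h \<le> v x}"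

definition valring :: "'l::field set \<Rightarrow> ('l \<Rightarrow> int) \<Rightarrow> 'l set" where
  "valring K v = {x\<in>K. x = 0 \<or> 0 \<le> v x}"

definition valunits :: "'l::field set \<Rightarrow> ('l \<Rightarrow> int) \<Rightarrow> 'l set" where
  "valunits K v = {x\<in>K. x \<noteq> 0 \<and> v x = 0}"

definition module_basis ::
  "'r::zero set \<Rightarrow> ('r \<Rightarrow> 'm::ab_group_add \<Rightarrow> 'm) \<Rightarrow> 'm set \<Rightarrow> ('i \<Rightarrow> 'm) \<Rightarrow> 'i set \<Rightarrow> bool" where
  "module_basis R smul M B S \<longleftrightarrow>
     (\<forall>s\<in>S. B s \<in> M) \<and>
     (\<forall>y\<in>M. \<exists>c. (\<forall>s\<in>S. c s \<in> R) \<and> y = (\<Sum>s\<in>S. smul (c s) (B s))) \<and>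
     (\<forall>c. (\<forall>s\<in>S. c s \<in> R) \<and> (\<Sum>s\<in>S. smul (c s) (B s)) = 0 \<longrightarrow> (\<forall>s\<in>S. c s = 0))"

definition free_module ::
  "'a::ring_1 set \<Rightarrow> ('a \<Rightarrow> 'm::ab_group_add \<Rightarrow> 'm) \<Rightarrow> 'm set \<Rightarrow> bool" where
  "free_module R act M \<longleftrightarrow> (\<exists>E. E \<subseteq> M \<and>
     (\<forall>y\<in>M. \<exists>c. finite {e\<in>E. c e \<noteq> 0} \<and> (\<forall>e\<in>E. c e \<in> R) \<and>
        y = (\<Sum>e\<in>{e\<in>E. c e \<noteq> 0}. act (c e) e)) \<and>
     (\<forall>c. finite {e\<in>E. c e \<noteq> 0} \<and> (\<forall>e\<in>E. c e \<in> R) \<and>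
        (\<Sum>e\<in>{e\<in>E. c e \<noteq> 0}. act (c e) e) = 0 \<longrightarrow> (\<forall>e\<in>E. c e = 0)))"

definition K_algebra_acting ::
  "'l::field set \<Rightarrow> ('l \<Rightarrow> 'a::ring_1) \<Rightarrow> ('a \<Rightarrow> 'l \<Rightarrow> 'l) \<Rightarrow> bool" where
  "K_algebra_acting K emb act \<longleftrightarrow>
     (\<forall>x\<in>K. \<forall>y\<in>K. emb (x + y) = emb x + emb y \<and> emb (x * y) = emb x * emb y) \<and>
     emb 1 = 1 \<and> (\<forall>x\<in>K. \<forall>\<alpha>. emb x * \<alpha> = \<alpha> * emb x) \<and>
     (\<forall>\<alpha> \<beta> x. act (\<alpha> * \<beta>) x = act \<alpha> (act \<beta> x)) \<and> (\<forall>x. act 1 x = x) \<and>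
     (\<forall>\<alpha> \<beta> x. act (\<alpha> + \<beta>) x = act \<alpha> x + act \<beta> x) \<and>
     (\<forall>\<alpha> x y. act \<alpha> (x + y) = act \<alpha> x + act \<alpha> y) \<and>
     (\<forall>k\<in>K. \<forall>x. act (emb k) x = k * x)"

definition digit :: "nat \<Rightarrow> nat \<Rightarrow> nat \<Rightarrow> nat" where
  "digit p s j = (s div p ^ j) mod p"

definition bfrak :: "nat \<Rightarrow> nat \<Rightarrow> (nat \<Rightarrow> int) \<Rightarrow> nat \<Rightarrow> int" where
  "bfrak p n bs s = (\<Sum>i=1..n. int (digit p s (n - i)) * int p ^ (n - i) * bs i)"

definition afrak :: "nat \<Rightarrow> nat \<Rightarrow> (nat \<Rightarrow> int) \<Rightarrow> int \<Rightarrow> nat" where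
  "afrak p n bs t = (THE a. a < p ^ n \<and> bfrak p n bs a mod int (p ^ n) = (- t) mod int (p ^ n))"

definition dpreceq :: "nat \<Rightarrow> nat \<Rightarrow> nat \<Rightarrow> nat \<Rightarrow> bool" where
  "dpreceq p n s t \<longleftrightarrow> (\<forall>i\<in>{1..n}. digit p s (n - i) \<le> digit p t (n - i))"

text \<open>x is congruent to 0 modulo m * P_L^T (T may be infinite, meaning x = 0).\<close>
definition within_tol :: "('l::field \<Rightarrow> int) \<Rightarrow> enat \<Rightarrow> 'l \<Rightarrow> 'l \<Rightarrow> bool" where
  "within_tol v T x m \<longleftrightarrow> (case T of \<infinity> \<Rightarrow> x = 0 | enat k \<Rightarrow> x = 0 \<or> v m + int k \<le> v x)"

definition scaffold ::
  "'l::field set \<Rightarrow> ('l \<Rightarrow> int) \<Rightarrow> ('a::ring_1 \<Rightarrow> 'l \<Rightarrow> 'l) \<Rightarrow> nat \<Rightarrow> nat \<Rightarrow> (nat \<Rightarrow> int)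
    \<Rightarrow> enat \<Rightarrow> (int \<Rightarrow> 'l) \<Rightarrow> (nat \<Rightarrow> 'a) \<Rightarrow> bool" where
  "scaffold K v act p n bs T lam Psi \<longleftrightarrow>
     1 \<le> T \<and>
     (\<forall>t. lam t \<noteq> 0 \<and> v (lam t) = t) \<and>
     (\<forall>t1 t2. t1 mod int (p ^ n) = t2 mod int (p ^ n) \<longrightarrow> lam t1 * inverse (lam t2) \<in> K) \<and>
     (\<forall>i\<in>{1..n}. act (Psi i) 1 = 0) \<and>
     (\<forall>i\<in>{1..n}. \<forall>t. \<exists>u\<in>valunits K v.
        (1 \<le> digit p (afrak p n bs t) (n - i) \<longrightarrow>
           within_tol v T (act (Psi i) (lam t) - u * lam (t + int (p ^ (n - i)) * bs i))
              (lam (t + int (p ^ (n - i)) * bs i))) \<and>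
        (digit p (afrak p n bs t) (n - i) = 0 \<longrightarrow>
           within_tol v T (act (Psi i) (lam t)) (lam (t + int (p ^ (n - i)) * bs i))))"

definition PsiPow :: "nat \<Rightarrow> nat \<Rightarrow> (nat \<Rightarrow> 'a::ring_1) \<Rightarrow> nat \<Rightarrow> 'a" where
  "PsiPow p n Psi s = prod_list (map (\<lambda>i. Psi i ^ digit p s (n - i)) (rev [1..<n+1]))"

definition bpt :: "nat \<Rightarrow> nat \<Rightarrow> (nat \<Rightarrow> int) \<Rightarrow> int \<Rightarrow> int" where
  "bpt p n bs h = (THE t. h \<le> t \<and> t < h + int (p ^ n) \<and> afrak p n bs t = p ^ n - 1)"

definition dfun :: "nat \<Rightarrow> nat \<Rightarrow> (nat \<Rightarrow> int) \<Rightarrow> int \<Rightarrow> nat \<Rightarrow> int" where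
  "dfun p n bs h s = (bfrak p n bs s + bpt p n bs h - h) div int (p ^ n)"

definition wfun :: "nat \<Rightarrow> nat \<Rightarrow> (nat \<Rightarrow> int) \<Rightarrow> int \<Rightarrow> nat \<Rightarrow> int" where
  "wfun p n bs h s = Min {dfun p n bs h u - dfun p n bs h (u - s) | u. u < p ^ n \<and> dpreceq p n s u}"

definition Phi :: "('l::field \<Rightarrow> 'a::ring_1) \<Rightarrow> 'l \<Rightarrow> nat \<Rightarrow> nat \<Rightarrow> (nat \<Rightarrow> int) \<Rightarrow> int
    \<Rightarrow> (nat \<Rightarrow> 'a) \<Rightarrow> nat \<Rightarrow> 'a" where
  "Phi emb \<pi> p n bs h Psi s = emb (\<pi> powi (- wfun p n bs h s)) * PsiPow p n Psi s"

definition assoc_order :: "('l::field \<Rightarrow> int) \<Rightarrow> ('a \<Rightarrow> 'l \<Rightarrow> 'l) \<Rightarrow> int \<Rightarrow> 'a set" where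
  "assoc_order v act h = {\<alpha>. \<forall>x\<in>Pideal v h. act \<alpha> x \<in> Pideal v h}"

end

theory Submission
  imports Defs
begin

text \<open>
  Since \<open>v (\<Psi> s \<cdot> \<rho>) = b + \<bb>(s)\<close> whenever \<open>v \<rho> = b\<close>, and these values are distinct modulo \<open>p\<^sup>n\<close>,
  the \<open>\<Phi> s\<close> form a \<open>K\<close>-basis of \<open>A\<close>. The elements \<open>e r = \<lambda>\<^bsub>t\<^esub>\<close> with \<open>t = b + \<bb>(r) - p\<^sup>n d(r)\<close>, which
  lies in the window \<open>[h, h + p\<^sup>n)\<close>, form an \<open>\<OO>\<close>-basis of \<open>\<PP> h\<close>, and modulo the scaffold error
  \<open>\<Phi> s \<cdot> e r\<close> is a multiple of \<open>e (r + s)\<close> of valuation \<open>p\<^sup>n (d(r + s) - d(r) - w(s))\<close> over \<open>K\<close> if \<open>r + s\<close>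
  is formed without carries in base \<open>p\<close>, and \<open>0\<close> otherwise. The weak assumption puts the error into
  \<open>\<PP> h\<close>, so that \<open>\<Phi> s \<in> \<AA>\<close>. If \<open>w = d\<close>, the \<open>\<Phi> s \<cdot> \<rho>\<close> have the valuations of the window, hence are an
  \<open>\<OO>\<close>-basis of \<open>\<PP> h\<close>, which gives freeness. Under the strong assumption the error vanishes modulo
  \<open>\<pi> \<PP> h\<close>. A combination of the \<open>\<Phi> s\<close> with a non-integral coefficient is then excluded by applying
  it to an \<open>e r\<close> at which the minimum defining \<open>w(s)\<close> is attained. If \<open>\<PP> h\<close> is free, it is
  generated by one element \<open>\<rho>\<close> for dimension reasons; the matrix of the \<open>\<Phi> s \<cdot> \<rho>\<close> in the basis \<open>e\<close> is
  upper triangular modulo \<open>\<pi>\<close> with diagonal entries of valuation at least \<open>p\<^sup>n (d(s) - w(s))\<close>, and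
  spanning forces these to be units.
\<close>

section \<open>Digits and shift parameters\<close>

lemma digit_less: "0 < p \<Longrightarrow> digit p s j < p"
  by (simp add: digit_def)

lemma digit_expansion_mod: "s mod p ^ n = (\<Sum>j<n. digit p s j * p ^ j)"
proof (induction n)
  case (Suc n)
  have "s mod p ^ Suc n = p ^ n * (s div p ^ n mod p) + s mod p ^ n"
    by (metis mod_mult2_eq power_Suc2)
  then show ?case using Suc by (simp add: digit_def)
qed simp

lemma digit_expansion: "s < p ^ n \<Longrightarrow> s = (\<Sum>j<n. digit p s j * p ^ j)"
  using digit_expansion_mod[of s p n] by simp

lemma digits_sum_less:
  fixes p :: nat
  assumes "\<And>j. j < n \<Longrightarrow> f j < p"
  shows "(\<Sum>j<n. f j * p ^ j) < p ^ n"
  using assms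
proof (induction n)
  case (Suc n)
  have "(\<Sum>j<Suc n. f j * p ^ j) < p ^ n + f n * p ^ n"
    using Suc by simp
  also have "\<dots> = (f n + 1) * p ^ n" by simp
  also have "\<dots> \<le> p * p ^ n" using Suc.prems[of n] by (intro mult_right_mono) auto
  finally show ?case by simp
qed simp

lemma digit_sum:
  assumes "\<And>j. j < n \<Longrightarrow> f j < p" "i < n"
  shows "digit p (\<Sum>j<n. f j * p ^ j) i = f i"
  using assms
proof (induction n)
  case (Suc n)
  let ?S = "\<Sum>j<n. f j * p ^ j"
  have p: "0 < p" using Suc.prems(1)[of n] by auto
  have S: "?S < p ^ n" using Suc.prems by (intro digits_sum_less) auto
  show ?case
  proof (cases "i = n")
    case True
    then show ?thesis using S p Suc.prems(1)[of n] by (simp add: digit_def)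
  next
    case False
    then have i: "i < n" using Suc.prems by simp
    then have "p ^ n = p ^ i * (p * p ^ (n - i - 1))"
      by (metis Suc_diff_Suc diff_Suc_eq_diff_pred le_add_diff_inverse less_imp_le power_Suc power_add diff_diff_left add.commute plus_1_eq_Suc)
    \<comment> \<open>Since \<open>i < n\<close>, the top term is \<open>p ^ i\<close> times a
      multiple of \<open>p\<close>, so it disappears from digit \<open>i\<close>.\<close>
    then have "(?S + f n * p ^ n) div p ^ i mod p = (?S + p ^ i * (f n * p ^ (n - i - 1) * p)) div p ^ i mod p"
      by (simp add: algebra_simps)
    also have "\<dots> = ?S div p ^ i mod p" using p by simp
    finally show ?thesis using Suc i by (simp add: digit_def)
  qed
qed simp

section \<open>Addition without carries in base \<open>p\<close>\<close>

text \<open>The partial order \<open>dpreceq\<close> is traded for this symmetric relation: below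
  \<open>p ^ n\<close>, \<open>s\<close> precedes \<open>u\<close> exactly when
  \<open>u = s + r\<close> without carry, and the action of \<open>\<Phi> s\<close> on
  \<open>e r\<close> is naturally indexed by the pair \<open>s\<close>, \<open>r\<close>.\<close>

definition no_carry :: "nat \<Rightarrow> nat \<Rightarrow> nat \<Rightarrow> nat \<Rightarrow> bool" where
  "no_carry p n s r \<longleftrightarrow> (\<forall>j<n. digit p s j + digit p r j < p)"

lemma add_eq_digit_sum:
  assumes "s < p ^ n" "r < p ^ n"
  shows "s + r = (\<Sum>j<n. (digit p s j + digit p r j) * p ^ j)"
  using digit_expansion[OF assms(1)] digit_expansion[OF assms(2)]
  by (simp add: sum.distrib algebra_simps)

lemma digit_add:
  assumes "s < p ^ n" "r < p ^ n" "no_carry p n s r"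
  shows "s + r < p ^ n" "\<And>j. j < n \<Longrightarrow> digit p (s + r) j = digit p s j + digit p r j"
  unfolding add_eq_digit_sum[OF assms(1,2)] using assms(3)
  by (auto intro!: digits_sum_less digit_sum simp: no_carry_def)

lemma dpreceq_iff: "dpreceq p n s t \<longleftrightarrow> (\<forall>j<n. digit p s j \<le> digit p t j)"
proof
  assume a: "dpreceq p n s t"
  show "\<forall>j<n. digit p s j \<le> digit p t j"
  proof (intro allI impI)
    fix j assume "j < n"
    then have "n - j \<in> {1..n}" "n - (n - j) = j" by auto
    then show "digit p s j \<le> digit p t j" using a unfolding dpreceq_def by metis
  qed
qed (auto simp: dpreceq_def)

lemma dpreceq_add:
  assumes "s < p ^ n" "r < p ^ n" "no_carry p n s r"
  shows "dpreceq p n s (s + r)"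
  using digit_add[OF assms] by (auto simp: dpreceq_iff)

text \<open>The witness is the digitwise difference; no borrow occurs because each digit of
  \<open>s\<close> is at most that of \<open>u\<close>.\<close>

lemma dpreceq_imp_no_carry:
  assumes p: "0 < p" and "s < p ^ n" "u < p ^ n" "dpreceq p n s u"
  obtains r where "r < p ^ n" "no_carry p n s r" "u = s + r"
proof
  let ?f = "\<lambda>j. digit p u j - digit p s j"
  let ?r = "\<Sum>j<n. ?f j * p ^ j"
  have f: "?f j < p" for j using digit_less[OF p, of u j] by auto
  show r: "?r < p ^ n" by (intro digits_sum_less f)
  have dr: "digit p ?r j = ?f j" if "j < n" for j using digit_sum[of n ?f p j] f that by auto
  have le: "digit p s j \<le> digit p u j" if "j < n" for j using that assms(4) by (simp add: dpreceq_iff)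
  show "no_carry p n s ?r"
    unfolding no_carry_def using dr le digit_less[OF p, of u] by simp
  have "s + ?r = (\<Sum>j<n. (digit p s j + ?f j) * p ^ j)"
    using digit_expansion[OF assms(2)] by (simp only: sum.distrib distrib_right)
  also have "\<dots> = (\<Sum>j<n. digit p u j * p ^ j)" using le by (intro sum.cong) auto
  also have "\<dots> = u" using digit_expansion[OF assms(3)] by simp
  finally show "u = s + ?r" by simp
qed

text \<open>All digits of \<open>p ^ n - 1\<close> equal \<open>p - 1\<close>, so the subtraction
  never borrows.\<close>

lemma digit_complement:
  assumes p: "0 < p" and r: "r < p ^ n" and j: "j < n"
  shows "digit p (p ^ n - 1 - r) j = p - 1 - digit p r j"
proof -
  let ?f = "\<lambda>j. p - 1 - digit p r j"
  have f: "?f j < p" for j using p by auto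
  have "(\<Sum>j<n. ?f j * p ^ j) + r = (\<Sum>j<n. (?f j + digit p r j) * p ^ j)"
    using digit_expansion[OF r] by (simp only: sum.distrib distrib_right)
  also have "\<dots> = (\<Sum>j<n. (p - 1) * p ^ j)"
    using digit_less[OF p, of r] by (intro sum.cong) (auto simp: Suc_leI less_Suc_eq_le)
  also have "\<dots> = p ^ n - 1"
    using p by (induction n) (auto simp: algebra_simps diff_mult_distrib Suc_leI)
  finally have "p ^ n - 1 - r = (\<Sum>j<n. ?f j * p ^ j)" by linarith
  then show ?thesis using digit_sum[of n ?f p j] f j by simp
qed

lemma bfrak_eq: "bfrak p n bs s = (\<Sum>j<n. int (digit p s j) * int p ^ j * bs (n - j))"
  unfolding bfrak_def
  by (rule sum.reindex_bij_witness[of _ "\<lambda>j. n - j" "\<lambda>i. n - i"]) auto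

lemma bfrak_0 [simp]: "bfrak p n bs 0 = 0"
  by (simp add: bfrak_def digit_def)

lemma bfrak_add:
  assumes "s < p ^ n" "r < p ^ n" "no_carry p n s r"
  shows "bfrak p n bs (s + r) = bfrak p n bs s + bfrak p n bs r"
  using digit_add(2)[OF assms] by (simp add: bfrak_eq sum.distrib[symmetric] algebra_simps)

text \<open>Modulo \<open>p\<close> only the term \<open>j = 0\<close> survives, and coprimality
  with the bound on \<open>x 0\<close> kills it; dividing by \<open>p\<close> continues the
  induction with the remaining terms. Applied to differences of digits, this makes
  \<open>bfrak\<close> injective modulo \<open>p ^ n\<close>.\<close>

lemma weighted_digits_dvd_imp_zero:
  fixes x \<beta> :: "nat \<Rightarrow> int"
  assumes "0 < p" "\<And>j. j < n \<Longrightarrow> \<bar>x j\<bar> < int p" "\<And>j. j < n \<Longrightarrow> coprime (\<beta> j) (int p)"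
    and "int p ^ n dvd (\<Sum>j<n. x j * int p ^ j * \<beta> j)" and "j < n"
  shows "x j = 0"
  using assms(2-)
proof (induction n arbitrary: x \<beta> j)
  case (Suc n)
  let ?S = "\<Sum>j<n. x (Suc j) * int p ^ j * \<beta> (Suc j)"
  have split: "(\<Sum>j<Suc n. x j * int p ^ j * \<beta> j) = x 0 * \<beta> 0 + int p * ?S"
    by (simp add: sum.lessThan_Suc_shift sum_distrib_left algebra_simps del: sum.lessThan_Suc)
  have "int p dvd x 0 * \<beta> 0"
  proof -
    have "int p dvd x 0 * \<beta> 0 + int p * ?S"
      using Suc.prems(3) unfolding split power_Suc by (rule dvd_mult_left)
    then show ?thesis by (simp add: dvd_add_left_iff)
  qed
  then have "int p dvd x 0"
    using Suc.prems(2)[of 0] by (simp add: coprime_commute coprime_dvd_mult_left_iff)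
  then have x0: "x 0 = 0" using Suc.prems(1)[of 0] dvd_imp_le_int by force
  have "int p ^ n dvd ?S" using Suc.prems(3) x0 \<open>0 < p\<close> unfolding split by simp
  then have "x (Suc i) = 0" if "i < n" for i
    using Suc.IH[of "\<lambda>j. x (Suc j)" "\<lambda>j. \<beta> (Suc j)" i] Suc.prems(1,2) that by simp
  then show ?case using x0 Suc.prems(4) by (cases j) auto
qed simp

section \<open>The residue map of the shift parameters\<close>

locale shift_parameters =
  fixes p n :: nat and bs :: "nat \<Rightarrow> int" and h :: int
  assumes prime_p: "prime p" and bs_coprime: "\<And>i. i \<in> {1..n} \<Longrightarrow> coprime (bs i) (int p)"
begin

abbreviation "q \<equiv> p ^ n"
abbreviation "\<bb> \<equiv> bfrak p n bs"
abbreviation "\<aa> \<equiv> afrak p n bs"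
abbreviation "b \<equiv> bpt p n bs h"
abbreviation "d \<equiv> dfun p n bs h"
abbreviation "w \<equiv> wfun p n bs h"

lemma p_pos: "0 < p" using prime_p by (simp add: prime_gt_0_nat)

lemma q_pos: "0 < q" using p_pos by simp

lemma bfrak_inj:
  assumes "s < q" "r < q" "\<bb> s mod int q = \<bb> r mod int q"
  shows "s = r"
proof -
  let ?x = "\<lambda>j. int (digit p s j) - int (digit p r j)"
  have "int p ^ n dvd \<bb> s - \<bb> r" using assms(3) by (simp add: mod_eq_dvd_iff)
  also have "\<bb> s - \<bb> r = (\<Sum>j<n. ?x j * int p ^ j * bs (n - j))"
    by (simp add: bfrak_eq sum_subtractf algebra_simps)
  finally have dvd: "int p ^ n dvd (\<Sum>j<n. ?x j * int p ^ j * bs (n - j))" .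
  have "?x j = 0" if "j < n" for j
  proof (rule weighted_digits_dvd_imp_zero[OF p_pos _ _ dvd that])
    show "\<bar>?x i\<bar> < int p" for i
      using digit_less[OF p_pos, of s i] digit_less[OF p_pos, of r i] by linarith
    show "coprime (bs (n - i)) (int p)" if "i < n" for i using bs_coprime[of "n - i"] that by auto
  qed
  then have "(\<Sum>j<n. digit p s j * p ^ j) = (\<Sum>j<n. digit p r j * p ^ j)" by (intro sum.cong) auto
  then show ?thesis using digit_expansion assms by metis
qed

text \<open>Reduced modulo \<open>q\<close>, \<open>\<bb>\<close> becomes an injective self-map of a
  set of \<open>q\<close> elements, hence onto; together with injectivity this makes
  \<open>afrak\<close> well defined.\<close>

lemma bfrak_surj: "\<exists>s<q. \<bb> s mod int q = t mod int q"
proof -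
  let ?f = "\<lambda>s. nat (\<bb> s mod int q)"
  have "inj_on ?f {..<q}"
    using bfrak_inj q_pos by (auto intro!: inj_onI simp: nat_eq_iff)
  moreover have "?f ` {..<q} \<subseteq> {..<q}" using q_pos by (auto simp: nat_less_iff)
  ultimately have "?f ` {..<q} = {..<q}" by (simp add: endo_inj_surj)
  moreover have "nat (t mod int q) \<in> {..<q}" using q_pos by (simp add: nat_less_iff)
  ultimately have "nat (t mod int q) \<in> ?f ` {..<q}" by blast
  then obtain s where s: "s < q" "nat (t mod int q) = ?f s" by auto
  have "0 \<le> t mod int q" "0 \<le> \<bb> s mod int q" using q_pos by auto
  then have "\<bb> s mod int q = t mod int q" using s(2) by (metis int_nat_eq)
  then show ?thesis using s(1) by blast
qed

lemma afrak: "\<aa> t < q" "\<bb> (\<aa> t) mod int q = (- t) mod int q"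
proof -
  have "\<exists>!a. a < q \<and> \<bb> a mod int q = (- t) mod int q"
    using bfrak_surj[of "- t"] bfrak_inj by metis
  from theI'[OF this] show "\<aa> t < q" "\<bb> (\<aa> t) mod int q = (- t) mod int q"
    unfolding afrak_def by auto
qed

lemma afrak_eq: "a < q \<Longrightarrow> \<bb> a mod int q = (- t) mod int q \<Longrightarrow> \<aa> t = a"
  using afrak[of t] bfrak_inj by metis

text \<open>The definite description needs existence and uniqueness: the witness \<open>?c\<close>
  represents \<open>- \<bb> (q - 1)\<close> in the window, and two solutions are congruent modulo
  \<open>q\<close> at distance below \<open>q\<close>.\<close>

lemma bpt: "h \<le> b" "b < h + int q" "\<aa> b = q - 1"
proof -
  let ?c = "h + (- \<bb> (q - 1) - h) mod int q"
  have c: "h \<le> ?c" "?c < h + int q" using q_pos by auto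
  have "(- ?c) mod int q = (- (h + (- \<bb> (q - 1) - h))) mod int q"
    by (metis mod_add_right_eq mod_minus_eq)
  then have "\<aa> ?c = q - 1" using q_pos by (intro afrak_eq) auto
  moreover have "t = t'"
    if "h \<le> t" "t < h + int q" "\<aa> t = q - 1" "h \<le> t'" "t' < h + int q" "\<aa> t' = q - 1" for t t'
  proof -
    have "(- t) mod int q = (- t') mod int q" using that afrak(2)[of t] afrak(2)[of t'] by simp
    then have "int q dvd t' - t" by (metis mod_eq_dvd_iff minus_diff_minus uminus_add_conv_diff diff_minus_eq_add add.commute)
    moreover have "\<bar>t' - t\<bar> < int q" using that by linarith
    ultimately show ?thesis using dvd_imp_le_int[of "t' - t" "int q"] by (cases "t' = t") auto
  qed
  ultimately have "\<exists>!t. h \<le> t \<and> t < h + int q \<and> \<aa> t = q - 1" using c by blast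
  from theI'[OF this] show "h \<le> b" "b < h + int q" "\<aa> b = q - 1" unfolding bpt_def by auto
qed

lemma afrak_shift:
  assumes "s < q" "r < q" "no_carry p n s r" "\<aa> t = s + r"
  shows "\<aa> (t + \<bb> s) = r"
proof (rule afrak_eq[OF assms(2)])
  have "\<bb> r = \<bb> (\<aa> t) - \<bb> s" using bfrak_add[OF assms(1-3)] assms(4) by simp
  then show "\<bb> r mod int q = (- (t + \<bb> s)) mod int q"
    using mod_diff_cong[OF afrak(2)[of t] refl, of "\<bb> s"] by (simp only: minus_add_distrib diff_conv_add_uminus)
qed

text \<open>Starting from \<open>\<aa> b = q - 1\<close>, whose digits are all maximal,
  \<open>r\<close> can be removed without a borrow; a multiple of \<open>q\<close> does not affect
  the residue.\<close>

lemma afrak_bpt_shift: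
  assumes "r < q"
  shows "\<aa> (b + \<bb> r - int q * k) = q - 1 - r"
proof (rule afrak_eq)
  have c: "q - 1 - r < q" "r + (q - 1 - r) = q - 1" using assms by auto
  have "no_carry p n r (q - 1 - r)"
    unfolding no_carry_def
  proof (intro allI impI)
    fix j assume "j < n"
    then show "digit p r j + digit p (q - 1 - r) j < p"
      using digit_complement[OF p_pos assms] digit_less[OF p_pos, of r j] by simp
  qed
  from bfrak_add[OF assms c(1) this, of bs] have "\<bb> (q - 1 - r) = \<bb> (\<aa> b) - \<bb> r"
    using c bpt by simp
  also have "\<dots> mod int q = (- b - \<bb> r) mod int q" using afrak(2)[of b] by (rule mod_diff_cong) simp
  also have "\<dots> = (- (b + \<bb> r - int q * k)) mod int q"
    using mod_mult_self2[of "- b - \<bb> r" "int q" k] by (simp add: algebra_simps)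
  finally show "\<bb> (q - 1 - r) mod int q = (- (b + \<bb> r - int q * k)) mod int q" .
qed (use assms in auto)

text \<open>Digits are numbered here as the operators \<open>Psi i\<close> are, not by powers of
  \<open>p\<close>: digit \<open>i\<close> counts how many times \<open>Psi i\<close> can act at
  \<open>t\<close> before its main term vanishes.\<close>

definition digit_at :: "int \<Rightarrow> nat \<Rightarrow> nat" where
  "digit_at t i = digit p (\<aa> t) (n - i)"

text \<open>The shift of \<open>Psi i\<close> is \<open>\<bb> (p ^ (n - i))\<close>, and
  \<open>p ^ (n - i)\<close> has a single nonzero digit, equal to 1; so one application uses up one
  unit of digit \<open>i\<close> and nothing else.\<close>

lemma digit_at_shift:
  assumes i: "i \<in> {1..n}" and pos: "1 \<le> digit_at t i"
  shows "digit_at (t + int (p ^ (n - i)) * bs i) i = digit_at t i - 1"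
    and "\<And>j. j \<in> {1..n} \<Longrightarrow> j \<noteq> i \<Longrightarrow> digit_at (t + int (p ^ (n - i)) * bs i) j = digit_at t j"
proof -
  let ?s = "p ^ (n - i)"
  have p2: "2 \<le> p" using prime_p by (rule prime_ge_2_nat)
  have s: "?s = (\<Sum>k<n. (if k = n - i then 1 else 0) * p ^ k)"
    using i by (simp add: if_distrib[of "\<lambda>x. x * _"] cong: if_cong)
  have ds: "digit p ?s k = (if k = n - i then 1 else 0)" if "k < n" for k
    unfolding s using digit_sum[of n "\<lambda>k. if k = n - i then 1 else 0" p k] that p2 by auto
  have sq: "?s < q" unfolding s by (rule digits_sum_less) (use p2 in auto)
  have bs: "\<bb> ?s = int ?s * bs i"
  proof -
    have "\<bb> ?s = (\<Sum>j<n. if j = n - i then int p ^ j * bs (n - j) else 0)"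
      unfolding bfrak_eq using ds by (intro sum.cong) auto
    then show ?thesis using i by simp
  qed
  have "dpreceq p n ?s (\<aa> t)" using ds pos by (auto simp: dpreceq_iff digit_at_def)
  then obtain r where r: "r < q" "no_carry p n ?s r" "\<aa> t = ?s + r"
    using dpreceq_imp_no_carry[OF p_pos sq afrak(1)] by blast
  have ar: "\<aa> (t + int ?s * bs i) = r" using afrak_shift[OF sq r] bs by simp
  have dig: "digit p (\<aa> t) k = digit p ?s k + digit p r k" if "k < n" for k
    unfolding r(3) using digit_add(2)[OF sq r(1,2) that] .
  show "digit_at (t + int ?s * bs i) i = digit_at t i - 1"
    unfolding digit_at_def ar using dig[of "n - i"] ds[of "n - i"] i by auto
  show "digit_at (t + int ?s * bs i) j = digit_at t j" if "j \<in> {1..n}" "j \<noteq> i" for j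
  proof -
    have "n - j \<noteq> n - i" using that i by auto
    then show ?thesis unfolding digit_at_def ar using dig[of "n - j"] ds[of "n - j"] that by auto
  qed
qed

text \<open>Division with remainder: \<open>d r\<close> is the multiple of \<open>q\<close> that
  brings \<open>b + \<bb> r\<close> back into the window starting at \<open>h\<close>.\<close>

lemma dfun_bounds: "h \<le> b + \<bb> r - int q * d r" "b + \<bb> r - int q * d r < h + int q"
proof -
  have "\<bb> r + b - h = int q * d r + (\<bb> r + b - h) mod int q" unfolding dfun_def by simp
  moreover have "0 \<le> (\<bb> r + b - h) mod int q" "(\<bb> r + b - h) mod int q < int q" using q_pos by auto
  ultimately show "h \<le> b + \<bb> r - int q * d r" "b + \<bb> r - int q * d r < h + int q" by linarith+
qed

lemma dfun_0: "d 0 = 0"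
  unfolding dfun_def using bpt by simp

lemma wfun_le:
  assumes "s < q" "r < q" "no_carry p n s r"
  shows "w s \<le> d (r + s) - d r"
proof -
  have "s + r < q \<and> dpreceq p n s (s + r)" using digit_add[OF assms] dpreceq_add[OF assms] by simp
  then show ?thesis unfolding wfun_def
    by (intro Min_le) (auto intro!: exI[of _ "s + r"] simp: add.commute)
qed

text \<open>This recasts the minimum over \<open>u\<close> as one over carry-free partners
  \<open>r = u - s\<close>, the form in which it meets the action on \<open>e r\<close>.\<close>

lemma wfun_attained:
  assumes s: "s < q"
  obtains r where "r < q" "no_carry p n s r" "w s = d (r + s) - d r"
proof -
  let ?M = "{d u - d (u - s) | u. u < q \<and> dpreceq p n s u}"
  have "?M \<noteq> {}" using s by (auto simp: dpreceq_def)
  then have "w s \<in> ?M" unfolding wfun_def by (intro Min_in) auto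
  then obtain u where u: "u < q" "dpreceq p n s u" "w s = d u - d (u - s)" by auto
  then obtain r where "r < q" "no_carry p n s r" "u = s + r"
    using dpreceq_imp_no_carry[OF p_pos s] by blast
  then show ?thesis using that[of r] u(3) by (simp add: add.commute)
qed

lemma no_carry_0: "no_carry p n s 0"
  using digit_less[OF p_pos] by (simp add: no_carry_def) (simp add: digit_def)

lemma wfun_le_dfun: "s < q \<Longrightarrow> w s \<le> d s"
  using wfun_le[of s 0] no_carry_0 q_pos dfun_0 by simp

text \<open>The digits of \<open>\<aa>\<close> at this point are the complements of those of
  \<open>r\<close> in \<open>p - 1\<close>, so dominating the digits of \<open>s\<close> amounts to
  carry-free addition. This translates the vanishing condition of the scaffold.\<close>

lemma no_carry_iff_digit_at:
  assumes "r < q"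
  shows "no_carry p n s r \<longleftrightarrow> (\<forall>i\<in>{1..n}. digit p s (n - i) \<le> digit_at (b + \<bb> r - int q * k) i)"
proof -
  have "(\<forall>i\<in>{1..n}. digit p s (n - i) \<le> digit_at (b + \<bb> r - int q * k) i)
      \<longleftrightarrow> dpreceq p n s (q - 1 - r)"
    unfolding digit_at_def afrak_bpt_shift[OF assms] dpreceq_def ..
  also have "\<dots> \<longleftrightarrow> (\<forall>j<n. digit p s j \<le> p - 1 - digit p r j)"
    unfolding dpreceq_iff using digit_complement[OF p_pos assms] by auto
  also have "\<dots> \<longleftrightarrow> no_carry p n s r"
  proof -
    have "x \<le> p - 1 - y \<longleftrightarrow> x + y < p" if "y < p" for x y using that by auto
    then show ?thesis unfolding no_carry_def using digit_less[OF p_pos, of r] by simp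
  qed
  finally show ?thesis ..
qed

abbreviation "\<sigma> i \<equiv> int (p ^ (n - i)) * bs i"

lemma digit_at_shift_mult:
  assumes "i \<in> {1..n}" "k \<le> digit_at t i"
  shows "digit_at (t + int k * \<sigma> i) i = digit_at t i - k"
    and "\<And>j. j \<in> {1..n} \<Longrightarrow> j \<noteq> i \<Longrightarrow> digit_at (t + int k * \<sigma> i) j = digit_at t j"
proof -
  have "digit_at (t + int k * \<sigma> i) i = digit_at t i - k \<and>
      (\<forall>j\<in>{1..n}. j \<noteq> i \<longrightarrow> digit_at (t + int k * \<sigma> i) j = digit_at t j)"
    using assms(2)
  proof (induction k)
    case (Suc k)
    have eq: "t + int (Suc k) * \<sigma> i = (t + int k * \<sigma> i) + \<sigma> i" by (simp add: algebra_simps)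
    have "1 \<le> digit_at (t + int k * \<sigma> i) i" using Suc by simp
    from digit_at_shift[OF assms(1) this] show ?case unfolding eq using Suc by auto
  qed simp
  then show "digit_at (t + int k * \<sigma> i) i = digit_at t i - k"
    and "\<And>j. j \<in> {1..n} \<Longrightarrow> j \<noteq> i \<Longrightarrow> digit_at (t + int k * \<sigma> i) j = digit_at t j" by auto
qed

text \<open>The factors \<open>Psi 1\<close> to \<open>Psi m\<close> use up only digits of index at
  most \<open>m\<close>, so the digits governing the later factors are intact when these
  act.\<close>

lemma digit_at_shift_sum:
  assumes "m \<le> n" "\<forall>i\<in>{1..m}. k i \<le> digit_at t i" "j \<in> {m<..n}"
  shows "digit_at (t + (\<Sum>i=1..m. int (k i) * \<sigma> i)) j = digit_at t j"
  using assms
proof (induction m arbitrary: j)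
  case (Suc m)
  let ?t = "t + (\<Sum>i=1..m. int (k i) * \<sigma> i)"
  have IH: "digit_at ?t j' = digit_at t j'" if "j' \<in> {m<..n}" for j'
    using Suc that by auto
  have "k (Suc m) \<le> digit_at ?t (Suc m)" using IH[of "Suc m"] Suc.prems by auto
  then have "digit_at (?t + int (k (Suc m)) * \<sigma> (Suc m)) j = digit_at ?t j"
    using Suc.prems by (intro digit_at_shift_mult(2)) auto
  then show ?case using IH[of j] Suc.prems by (simp add: add.assoc)
qed simp

end

section \<open>Linear algebra over a subfield\<close>

lemma subfield_sum: "subfield K \<Longrightarrow> (\<And>i. i \<in> I \<Longrightarrow> f i \<in> K) \<Longrightarrow> sum f I \<in> K"
  by (induction I rule: infinite_finite_induct) (auto simp: subfield_def)

lemma subfield_uminus: "subfield K \<Longrightarrow> x \<in> K \<Longrightarrow> - x \<in> K"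
  unfolding subfield_def using diff_0[of x] by fastforce

text \<open>Gaussian elimination by induction on the equations: one with a nonzero coefficient at
  \<open>j0\<close> is solved for that unknown and substituted into the others, all within
  \<open>K\<close>.\<close>

lemma homogeneous_system_nontrivial_solution:
  fixes K :: "'l::field set"
  assumes K: "subfield K" and "finite I" "finite J" "card I < card J"
    and "\<And>i j. i \<in> I \<Longrightarrow> j \<in> J \<Longrightarrow> a i j \<in> K"
  shows "\<exists>y. (\<forall>j\<in>J. y j \<in> K) \<and> (\<exists>j\<in>J. y j \<noteq> 0) \<and> (\<forall>i\<in>I. (\<Sum>j\<in>J. a i j * y j) = 0)"
  using assms(2-)
proof (induction I arbitrary: J a rule: finite_induct)
  case empty
  then show ?case using K by (intro exI[of _ "\<lambda>_. 1"]) (auto simp: subfield_def card_gt_0_iff)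
next
  case (insert i0 I)
  show ?case
  proof (cases "\<exists>j\<in>J. a i0 j \<noteq> 0")
    case False
    then have "(\<Sum>j\<in>J. a i0 j * y j) = 0" for y by (intro sum.neutral) auto
    moreover have "\<exists>y. (\<forall>j\<in>J. y j \<in> K) \<and> (\<exists>j\<in>J. y j \<noteq> 0) \<and> (\<forall>i\<in>I. (\<Sum>j\<in>J. a i j * y j) = 0)"
      using insert.prems insert.hyps by (intro insert.IH) auto
    ultimately show ?thesis by auto
  next
    case True
    then obtain j0 where j0: "j0 \<in> J" "a i0 j0 \<noteq> 0" by blast
    define J' where "J' = J - {j0}"
    define a' where "a' = (\<lambda>i j. a i j - a i j0 * (a i0 j * inverse (a i0 j0)))"
    have "a' i j \<in> K" if "i \<in> I" "j \<in> J'" for i j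
      using that insert.prems(3) j0 K unfolding a'_def J'_def subfield_def by auto
    moreover have "card I < card J'" "finite J'"
      using insert.prems insert.hyps j0 by (auto simp: J'_def)
    ultimately obtain y where y: "\<forall>j\<in>J'. y j \<in> K" "\<exists>j\<in>J'. y j \<noteq> 0"
      "\<And>i. i \<in> I \<Longrightarrow> (\<Sum>j\<in>J'. a' i j * y j) = 0"
      using insert.IH[of J' a'] by blast
    \<comment> \<open>The value of the eliminated unknown, forced by equation
      \<open>i0\<close>.\<close>
    define c where "c = - ((\<Sum>j\<in>J'. a i0 j * y j) * inverse (a i0 j0))"
    define z where "z = y(j0 := c)"
    have sum_z: "(\<Sum>j\<in>J. a i j * z j) = a i j0 * c + (\<Sum>j\<in>J'. a i j * y j)" for i
    proof -
      have "(\<Sum>j\<in>J. a i j * z j) = a i j0 * z j0 + (\<Sum>j\<in>J'. a i j * z j)"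
        unfolding J'_def using j0 insert.prems(1) by (intro sum.remove) auto
      also have "(\<Sum>j\<in>J'. a i j * z j) = (\<Sum>j\<in>J'. a i j * y j)"
        by (intro sum.cong) (auto simp: z_def J'_def)
      finally show ?thesis by (simp add: z_def)
    qed
    have "(\<Sum>j\<in>J'. a i0 j * y j) \<in> K"
      using y(1) insert.prems(3) K by (intro subfield_sum) (auto simp: J'_def subfield_def)
    then have "c \<in> K"
      unfolding c_def using K j0 insert.prems(3)[of i0 j0]
      by (intro subfield_uminus) (auto simp: subfield_def)
    then have "\<forall>j\<in>J. z j \<in> K" using y(1) by (auto simp: z_def J'_def)
    moreover have "\<exists>j\<in>J. z j \<noteq> 0" using y(2) by (auto simp: z_def J'_def)
    moreover have "(\<Sum>j\<in>J. a i0 j * z j) = 0" unfolding sum_z c_def using j0 by simp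
    moreover have "(\<Sum>j\<in>J. a i j * z j) = 0" if "i \<in> I" for i
    proof -
      have "(\<Sum>j\<in>J'. a' i j * y j) = (\<Sum>j\<in>J'. a i j * y j) + a i j0 * c"
        unfolding a'_def c_def
        by (simp add: sum_subtractf left_diff_distrib sum_distrib_left sum_distrib_right algebra_simps)
      then show ?thesis using y(3)[OF that] unfolding sum_z by (simp add: add.commute)
    qed
    ultimately show ?thesis by (intro exI[of _ z]) auto
  qed
qed

locale subfield_vector_space =
  fixes K :: "'l::field set" and smul :: "'l \<Rightarrow> 'm::ab_group_add \<Rightarrow> 'm"
  assumes K: "subfield K"
    and smul_add_left: "\<And>x y m. x \<in> K \<Longrightarrow> y \<in> K \<Longrightarrow> smul (x + y) m = smul x m + smul y m"
    and smul_add_right: "\<And>x m m'. x \<in> K \<Longrightarrow> smul x (m + m') = smul x m + smul x m'"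
    and smul_smul: "\<And>x y m. x \<in> K \<Longrightarrow> y \<in> K \<Longrightarrow> smul x (smul y m) = smul (x * y) m"
    and smul_one: "\<And>m. smul 1 m = m"
begin

lemma K_closed:
  "0 \<in> K" "1 \<in> K" "x \<in> K \<Longrightarrow> y \<in> K \<Longrightarrow> x + y \<in> K" "x \<in> K \<Longrightarrow> y \<in> K \<Longrightarrow> x - y \<in> K"
  "x \<in> K \<Longrightarrow> y \<in> K \<Longrightarrow> x * y \<in> K" "x \<in> K \<Longrightarrow> inverse x \<in> K" "x \<in> K \<Longrightarrow> - x \<in> K"
  using K subfield_uminus by (auto simp: subfield_def)

lemma smul_zero_left: "smul 0 m = 0"
  using smul_add_left[of 0 0 m] K_closed by simp

lemma smul_zero_right: "x \<in> K \<Longrightarrow> smul x 0 = 0"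
  using smul_add_right[of x 0 0] by simp

lemma smul_sum_right: "x \<in> K \<Longrightarrow> smul x (sum f I) = (\<Sum>i\<in>I. smul x (f i))"
  by (induction I rule: infinite_finite_induct) (auto simp: smul_zero_right smul_add_right)

lemma smul_sum_left: "(\<And>i. i \<in> I \<Longrightarrow> f i \<in> K) \<Longrightarrow> smul (sum f I) m = (\<Sum>i\<in>I. smul (f i) m)"
proof (induction I rule: infinite_finite_induct)
  case (insert i I)
  then show ?case using subfield_sum[OF K, of I f] by (simp add: smul_add_left)
qed (auto simp: smul_zero_left)

text \<open>Dimension count: in coordinates with respect to \<open>B\<close>, a relation between the
  \<open>E s\<close> and one more vector \<open>x\<close> is a system of \<open>N\<close> equations
  in \<open>N + 1\<close> unknowns, so a nontrivial one exists. Independence keeps the coefficient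
  of \<open>x\<close> nonzero, and \<open>x\<close> can be solved for.\<close>

lemma independent_imp_basis:
  assumes basis: "module_basis K smul UNIV B {..<N::nat}"
    and indep: "\<And>c. (\<forall>s<N. c s \<in> K) \<Longrightarrow> (\<Sum>s<N. smul (c s) (E s)) = 0 \<Longrightarrow> \<forall>s<N. c s = 0"
  shows "module_basis K smul UNIV E {..<N}"
proof -
  have "\<exists>c. (\<forall>s\<in>{..<N}. c s \<in> K) \<and> x = (\<Sum>s<N. smul (c s) (E s))" for x
  proof -
    define F where "F = (\<lambda>j. if j < N then E j else x)"
    have "\<forall>j. \<exists>c. (\<forall>i<N. c i \<in> K) \<and> F j = (\<Sum>i<N. smul (c i) (B i))"
      using basis by (simp add: module_basis_def Ball_def)
    then obtain a where a: "\<And>i j. i < N \<Longrightarrow> a j i \<in> K" "\<And>j. F j = (\<Sum>i<N. smul (a j i) (B i))"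
      by metis
    have "\<exists>y. (\<forall>j\<in>{..N}. y j \<in> K) \<and> (\<exists>j\<in>{..N}. y j \<noteq> 0) \<and>
        (\<forall>i\<in>{..<N}. (\<Sum>j\<in>{..N}. a j i * y j) = 0)"
      using a(1) by (intro homogeneous_system_nontrivial_solution[OF K]) auto
    then obtain y where y: "\<And>j. j \<le> N \<Longrightarrow> y j \<in> K" "\<exists>j\<in>{..N}. y j \<noteq> 0"
      "\<And>i. i < N \<Longrightarrow> (\<Sum>j\<le>N. a j i * y j) = 0"
      by auto
    have "(\<Sum>j\<le>N. smul (y j) (F j)) = (\<Sum>j\<le>N. \<Sum>i<N. smul (a j i * y j) (B i))"
      unfolding a(2) using y(1) a(1)
      by (intro sum.cong) (auto simp: smul_sum_right smul_smul mult.commute intro!: sum.cong)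
    also have "\<dots> = (\<Sum>i<N. \<Sum>j\<le>N. smul (a j i * y j) (B i))" by (rule sum.swap)
    also have "\<dots> = (\<Sum>i<N. smul (\<Sum>j\<le>N. a j i * y j) (B i))"
      using y(1) a(1) K_closed by (intro sum.cong smul_sum_left[symmetric]) auto
    also have "\<dots> = 0" using y(3) by (simp add: smul_zero_left)
    finally have rel: "(\<Sum>j<N. smul (y j) (E j)) + smul (y N) x = 0"
      unfolding lessThan_Suc_atMost[symmetric] by (simp add: F_def)
    have yN: "y N \<noteq> 0"
    proof
      assume "y N = 0"
      then have "(\<Sum>j<N. smul (y j) (E j)) = 0" using rel by (simp add: smul_zero_left)
      then have "\<forall>j<N. y j = 0" using y(1) by (intro indep) auto
      then show False using y(2) \<open>y N = 0\<close> by (metis atMost_iff le_neq_implies_less)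
    qed
    have neg: "smul (- y N) x = (\<Sum>j<N. smul (y j) (E j))"
    proof -
      have "smul (- y N) x + smul (y N) x = 0"
        using smul_add_left[of "- y N" "y N" x] y(1)[of N] K_closed by (simp add: smul_zero_left)
      then have "smul (- y N) x + smul (y N) x = (\<Sum>j<N. smul (y j) (E j)) + smul (y N) x"
        using rel by (rule trans[OF _ sym])
      then show ?thesis by (rule add_right_imp_eq)
    qed
    define c where "c = (\<lambda>j. inverse (- y N) * y j)"
    have cK: "\<forall>s\<in>{..<N}. c s \<in> K" unfolding c_def using y(1) K_closed by auto
    have "x = smul (inverse (- y N)) (smul (- y N) x)"
    proof -
      have "inverse (- y N) * - y N = 1" using yN by (intro left_inverse) simp
      then show ?thesis using y(1)[of N] K_closed(6,7) by (simp only: smul_smul smul_one le_refl)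
    qed
    also have "\<dots> = (\<Sum>j<N. smul (c j) (E j))"
      unfolding neg c_def using y(1) K_closed by (simp add: smul_sum_right smul_smul del: inverse_minus_eq)
    finally show ?thesis using cK by blast
  qed
  then show ?thesis using indep by (auto simp: module_basis_def)
qed

end

section \<open>Valuations\<close>

locale valued_field =
  fixes v :: "'l::field \<Rightarrow> int"
  assumes v_disc: "discrete_valuation v"
begin

abbreviation "\<PP> \<equiv> Pideal v"

lemma v_mult: "x \<noteq> 0 \<Longrightarrow> y \<noteq> 0 \<Longrightarrow> v (x * y) = v x + v y"
  using v_disc by (simp add: discrete_valuation_def)

lemma v_one: "v 1 = 0"
  using v_mult[of 1 1] by simp

lemma v_inverse: "x \<noteq> 0 \<Longrightarrow> v (inverse x) = - v x"
  using v_mult[of x "inverse x"] v_one by simp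

lemma v_uminus: "v (- x) = v x"
proof (cases "x = 0")
  case False
  have "v (- 1) = 0" using v_mult[of "- 1" "- 1"] v_one by simp
  then show ?thesis using v_mult[of "- 1" x] False by simp
qed simp

lemma v_powi: "x \<noteq> 0 \<Longrightarrow> v (x powi k) = k * v x"
proof -
  assume x: "x \<noteq> 0"
  have pow: "v (x ^ m) = int m * v x" for m
    using x by (induction m) (auto simp: v_one v_mult algebra_simps)
  then show ?thesis using x by (cases "0 \<le> k") (auto simp: power_int_def v_inverse power_inverse)
qed

lemma P_zero: "0 \<in> \<PP> m" by (simp add: Pideal_def)

lemma P_self: "x \<in> \<PP> (v x)" by (simp add: Pideal_def)

lemma P_mono: "x \<in> \<PP> m \<Longrightarrow> m' \<le> m \<Longrightarrow> x \<in> \<PP> m'" by (auto simp: Pideal_def)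

lemma P_uminus: "x \<in> \<PP> m \<Longrightarrow> - x \<in> \<PP> m" by (auto simp: Pideal_def v_uminus)

lemma P_add: "x \<in> \<PP> m \<Longrightarrow> y \<in> \<PP> m \<Longrightarrow> x + y \<in> \<PP> m"
proof (cases "x = 0 \<or> y = 0 \<or> x + y = 0")
  case False
  assume "x \<in> \<PP> m" "y \<in> \<PP> m"
  moreover have "min (v x) (v y) \<le> v (x + y)"
    using v_disc False by (simp add: discrete_valuation_def)
  ultimately show ?thesis using False by (simp add: Pideal_def)
qed (auto simp: Pideal_def)

lemma P_diff: "x \<in> \<PP> m \<Longrightarrow> y \<in> \<PP> m \<Longrightarrow> x - y \<in> \<PP> m"
  using P_add[of x m "- y"] P_uminus by simp

lemma P_sum: "(\<And>i. i \<in> I \<Longrightarrow> f i \<in> \<PP> m) \<Longrightarrow> sum f I \<in> \<PP> m"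
  by (induction I rule: infinite_finite_induct) (auto simp: P_zero P_add)

lemma P_mult: "x \<in> \<PP> m \<Longrightarrow> y \<in> \<PP> m' \<Longrightarrow> x * y \<in> \<PP> (m + m')"
  by (cases "x = 0"; cases "y = 0") (auto simp: Pideal_def v_mult)

lemma v_eqI:
  assumes "x \<noteq> 0" "y - x \<in> \<PP> (v x + 1)"
  shows "y \<noteq> 0" "v y = v x"
proof -
  have nx: "x \<notin> \<PP> (v x + 1)" using assms(1) by (simp add: Pideal_def)
  show y: "y \<noteq> 0" using assms(2) nx P_uminus by fastforce
  have "y \<in> \<PP> (v x)" using P_add[OF P_self[of x] P_mono[OF assms(2)]] by simp
  moreover have "y \<notin> \<PP> (v x + 1)" using nx P_diff[OF _ assms(2), of y] by auto
  ultimately show "v y = v x" using y by (auto simp: Pideal_def)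
qed

text \<open>No cancellation: if a term failed the bound, so would the nonzero term of least
  valuation; all other nonzero terms being of larger valuation, it would be a difference of elements
  of larger valuation.\<close>

lemma sum_distinct_valuations:
  assumes "finite I" "inj_on (\<lambda>i. v (x i)) {i\<in>I. x i \<noteq> 0}" "sum x I \<in> \<PP> m" "i \<in> I"
  shows "x i \<in> \<PP> m"
proof (rule ccontr)
  assume not: "x i \<notin> \<PP> m"
  let ?N = "{i\<in>I. x i \<noteq> 0}"
  have "finite ?N" "i \<in> ?N" using assms not by (auto simp: Pideal_def)
  define k where "k = arg_min_on (\<lambda>i. v (x i)) ?N"
  have k: "k \<in> ?N" "\<And>j. j \<in> ?N \<Longrightarrow> v (x k) \<le> v (x j)"
    using arg_min_if_finite[of ?N "\<lambda>i. v (x i)"] \<open>finite ?N\<close> \<open>i \<in> ?N\<close>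
    unfolding k_def[symmetric] by (blast, force)
  have "v (x k) + 1 \<le> m" using k(2)[OF \<open>i \<in> ?N\<close>] not by (auto simp: Pideal_def)
  then have "sum x I \<in> \<PP> (v (x k) + 1)" using assms(3) P_mono by blast
  moreover have "(\<Sum>j\<in>I - {k}. x j) \<in> \<PP> (v (x k) + 1)"
  proof (rule P_sum)
    fix j assume j: "j \<in> I - {k}"
    show "x j \<in> \<PP> (v (x k) + 1)"
    proof (cases "x j = 0")
      case False
      then have "v (x j) \<noteq> v (x k)" using inj_onD[OF assms(2), of j k] j k(1) by auto
      then show ?thesis using k(2)[of j] j False by (auto simp: Pideal_def)
    qed (simp add: P_zero)
  qed
  moreover have "x k = sum x I - (\<Sum>j\<in>I - {k}. x j)"
    using k(1) assms(1) by (simp add: sum_diff1)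
  ultimately have "x k \<in> \<PP> (v (x k) + 1)" using P_diff by metis
  then show False using k(1) by (simp add: Pideal_def)
qed

lemma P_cancel: "c * y \<in> \<PP> m \<Longrightarrow> y \<noteq> 0 \<Longrightarrow> v y < m \<Longrightarrow> c \<in> \<PP> 1"
  by (cases "c = 0") (auto simp: Pideal_def v_mult)

text \<open>Reading the hypothesis modulo the maximal ideal: an upper triangular matrix whose rows span must
  have an invertible diagonal.\<close>

lemma triangular_spanning_diagonal_unit:
  fixes M :: "nat \<Rightarrow> nat \<Rightarrow> 'l"
  assumes integral: "\<And>s u. s < N \<Longrightarrow> u < N \<Longrightarrow> M s u \<in> \<PP> 0"
    and triangular: "\<And>s u. u < s \<Longrightarrow> M s u = 0"
    and spanning: "\<And>k. k < N \<Longrightarrow> \<exists>c. (\<forall>s<N. c s \<in> \<PP> 0) \<and>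
      (\<forall>u<N. (if u = k then 1 else 0) - (\<Sum>s<N. c s * M s u) \<in> \<PP> 1)"
    and "k < N"
  shows "M k k \<notin> \<PP> 1"
  using \<open>k < N\<close>
proof (induction k rule: less_induct)
  case (less k)
  obtain c where c: "\<And>s. s < N \<Longrightarrow> c s \<in> \<PP> 0"
    "\<And>u. u < N \<Longrightarrow> (if u = k then 1 else 0) - (\<Sum>s<N. c s * M s u) \<in> \<PP> 1"
    using spanning[OF less.prems] by blast
  have split: "(\<Sum>s<N. c s * M s u) = (\<Sum>s<u. c s * M s u) + c u * M u u" if "u < N" for u
  proof -
    have "(\<Sum>s<N. c s * M s u) = (\<Sum>s<Suc u. c s * M s u)"
      using that triangular by (intro sum.mono_neutral_right) auto
    then show ?thesis by simp
  qed
  have low: "(\<Sum>s<u. c s * M s u) \<in> \<PP> 1" if "u < N" "\<And>s. s < u \<Longrightarrow> c s \<in> \<PP> 1" for u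
    using that integral P_mult[of _ 1 _ 0] by (intro P_sum) auto
  \<comment> \<open>Forward substitution: entry \<open>u < k\<close> of unit vector \<open>k\<close>
    is zero, the earlier coefficients are already in the maximal ideal, and \<open>M u u\<close> is
    a unit by the outer induction.\<close>
  have c1: "c u \<in> \<PP> 1" if "u < k" for u
    using that
  proof (induction u rule: less_induct)
    case (less u)
    then have u: "u < N" using \<open>k < N\<close> by simp
    have "- (\<Sum>s<N. c s * M s u) \<in> \<PP> 1" using c(2)[OF u] less.prems by simp
    then have "(\<Sum>s<N. c s * M s u) \<in> \<PP> 1" using P_uminus by fastforce
    moreover have "(\<Sum>s<u. c s * M s u) \<in> \<PP> 1"
      using u less by (intro low) auto
    ultimately have "c u * M u u \<in> \<PP> 1" using P_diff split[OF u] by fastforce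
    moreover have "M u u \<notin> \<PP> 1" using \<open>\<And>y. y < k \<Longrightarrow> y < N \<Longrightarrow> M y y \<notin> \<PP> 1\<close> less.prems u by blast
    ultimately show ?case using integral[OF u u]
      by (cases "c u = 0") (auto simp: Pideal_def v_mult)
  qed
  show ?case
  proof
    \<comment> \<open>Column \<open>k\<close> would then place 1 in the maximal ideal.\<close>
    assume "M k k \<in> \<PP> 1"
    then have "c k * M k k \<in> \<PP> 1" using c(1)[OF less.prems] P_mult[of "c k" 0 _ 1] by simp
    then have "(\<Sum>s<N. c s * M s k) \<in> \<PP> 1"
      unfolding split[OF less.prems] using low[OF less.prems] c1 by (intro P_add) auto
    then have "(1 - (\<Sum>s<N. c s * M s k)) + (\<Sum>s<N. c s * M s k) \<in> \<PP> 1"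
      using c(2)[OF less.prems] by (intro P_add) auto
    then show False by (simp add: Pideal_def v_one)
  qed
qed

end

section \<open>Totally ramified extensions\<close>

text \<open>\<open>v\<close> is normalized on the large field, so total ramification of degree
  \<open>q\<close> is expressed by the value group on \<open>K\<close> being the multiples of
  \<open>q\<close>.\<close>

locale ramified_extension = valued_field v
  for v :: "'l::field \<Rightarrow> int" +
  fixes K :: "'l set" and q :: nat
  assumes K_sub: "subfield K"
    and K_norm: "{v x | x. x \<in> K \<and> x \<noteq> 0} = {int q * k | k. True}"
    and deg_L: "\<exists>B. module_basis K (*) UNIV B {..<q}"
    and degree_pos: "0 < q"

sublocale ramified_extension \<subseteq> L: subfield_vector_space K "(*)"
  by unfold_locales (auto simp: K_sub algebra_simps)

context ramified_extension
begin

lemma v_K: "x \<in> K \<Longrightarrow> x \<noteq> 0 \<Longrightarrow> v x mod int q = 0"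
proof -
  assume "x \<in> K" "x \<noteq> 0"
  then have "v x \<in> {int q * k | k. True}" unfolding K_norm[symmetric] by blast
  then show ?thesis by auto
qed

text \<open>Scalars from \<open>K\<close> shift valuations by multiples of \<open>q\<close>, so a
  \<open>K\<close>-combination of such a family has no cancellation, and valuation bounds on it hold
  term by term.\<close>

definition distinct_mod :: "(nat \<Rightarrow> 'l) \<Rightarrow> bool" where
  "distinct_mod y \<longleftrightarrow> (\<forall>i<q. y i \<noteq> 0) \<and> inj_on (\<lambda>i. v (y i) mod int q) {..<q}"

lemma distinct_mod_terms:
  assumes y: "distinct_mod y" and c: "\<forall>i<q. c i \<in> K" and S: "(\<Sum>i<q. c i * y i) \<in> \<PP> m" and i: "i < q"
  shows "c i * y i \<in> \<PP> m"
proof -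
  have "inj_on (\<lambda>i. v (c i * y i)) {i\<in>{..<q}. c i * y i \<noteq> 0}"
  proof (rule inj_onI)
    fix i j assume i: "i \<in> {i\<in>{..<q}. c i * y i \<noteq> 0}" and j: "j \<in> {i\<in>{..<q}. c i * y i \<noteq> 0}"
      and e: "v (c i * y i) = v (c j * y j)"
    have "v (c k * y k) mod int q = v (y k) mod int q" if "k \<in> {i\<in>{..<q}. c i * y i \<noteq> 0}" for k
      using that v_K[of "c k"] c by (auto simp: v_mult mod_add_eq[symmetric, of "v (c k)"])
    then have "v (y i) mod int q = v (y j) mod int q" using i j e by metis
    then show "i = j" using y i j inj_onD unfolding distinct_mod_def by fastforce
  qed
  from sum_distinct_valuations[OF finite_lessThan this S] i show ?thesis by simp
qed

lemma distinct_mod_independent: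
  assumes "distinct_mod y" "\<forall>i<q. c i \<in> K" "(\<Sum>i<q. c i * y i) = 0"
  shows "\<forall>i<q. c i = 0"
proof (intro allI impI)
  fix i assume i: "i < q"
  have "c i * y i \<in> \<PP> (v (c i * y i) + 1)"
    using distinct_mod_terms[OF assms(1,2) _ i] assms(3) P_zero by metis
  then have "c i * y i = 0" by (auto simp: Pideal_def)
  then show "c i = 0" using assms(1) i by (auto simp: distinct_mod_def)
qed

lemma distinct_mod_basis:
  assumes "distinct_mod y"
  shows "module_basis K (*) UNIV y {..<q}"
proof -
  obtain B where "module_basis K (*) UNIV B {..<q}" using deg_L by blast
  then show ?thesis
    by (rule L.independent_imp_basis) (rule distinct_mod_independent[OF assms])
qed

lemma distinct_mod_expansion:
  assumes "distinct_mod y" "x \<in> \<PP> m"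
  obtains c where "\<And>i. i < q \<Longrightarrow> c i \<in> K" "x = (\<Sum>i<q. c i * y i)" "\<And>i. i < q \<Longrightarrow> c i * y i \<in> \<PP> m"
proof -
  obtain c where c: "\<forall>i<q. c i \<in> K" "x = (\<Sum>i<q. c i * y i)"
    using distinct_mod_basis[OF assms(1)] unfolding module_basis_def
    by (metis UNIV_I lessThan_iff)
  then show ?thesis using that distinct_mod_terms[OF assms(1) c(1)] assms(2) by metis
qed

text \<open>A nonzero \<open>c\<close> has valuation a multiple of \<open>q\<close> exceeding
  \<open>- q\<close>, hence nonnegative. In this way membership in an ideal becomes integrality of
  coefficients.\<close>

lemma K_mult_in_P:
  assumes "c \<in> K" "y \<noteq> 0" "v y < m + int q" "c * y \<in> \<PP> m"
  shows "c \<in> valring K v"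
proof (cases "c = 0")
  case False
  have "m \<le> v c + v y" using assms False by (auto simp: Pideal_def v_mult)
  then have "- int q < v c" using assms(3) by linarith
  moreover obtain k where k: "v c = int q * k" using v_K[OF assms(1) False] by auto
  ultimately have "int q * (- 1) < int q * k" by simp
  then have "0 \<le> k" using degree_pos by (simp only: mult_less_cancel_left) auto
  then show ?thesis using assms(1) k by (simp add: valring_def)
qed (use L.K_closed in \<open>auto simp: valring_def\<close>)

lemma valring_P: "c \<in> valring K v \<longleftrightarrow> c \<in> K \<and> c \<in> \<PP> 0"
  by (auto simp: valring_def Pideal_def)

lemma valring_K: "c \<in> valring K v \<Longrightarrow> c \<in> K"
  by (simp add: valring_P)

lemma valring_mult_P: "c \<in> valring K v \<Longrightarrow> x \<in> \<PP> m \<Longrightarrow> c * x \<in> \<PP> m"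
  using P_mult[of c 0 x m] by (simp add: valring_P)

lemma valring_closed:
  "0 \<in> valring K v" "1 \<in> valring K v"
  "x \<in> valring K v \<Longrightarrow> y \<in> valring K v \<Longrightarrow> x * y \<in> valring K v"
  using P_mult[of x 0 y 0] L.K_closed P_zero P_self[of 1] by (simp_all add: valring_P v_one)

lemma expansion_in_window:
  assumes "distinct_mod y" "\<And>i. i < q \<Longrightarrow> v (y i) < m + int q" "x \<in> \<PP> m"
  obtains c where "\<And>i. i < q \<Longrightarrow> c i \<in> valring K v" "x = (\<Sum>i<q. c i * y i)"
proof -
  obtain c where c: "\<And>i. i < q \<Longrightarrow> c i \<in> K" "x = (\<Sum>i<q. c i * y i)" "\<And>i. i < q \<Longrightarrow> c i * y i \<in> \<PP> m"
    using distinct_mod_expansion[OF assms(1,3)] by metis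
  then show ?thesis
    using that[of c] K_mult_in_P assms(1,2) unfolding distinct_mod_def by metis
qed

end

section \<open>Scaffolds\<close>

text \<open>The tolerance is a natural number here; an infinite one is lowered to a finite threshold
  before the locale is used.\<close>

locale scaffolded_extension =
  shift_parameters p n bs h + ramified_extension v K "p ^ n"
  for p n :: nat and bs :: "nat \<Rightarrow> int" and h :: int and v :: "'l::field \<Rightarrow> int" and K :: "'l set" +
  fixes emb :: "'l \<Rightarrow> 'a::ring_1" and act :: "'a \<Rightarrow> 'l \<Rightarrow> 'l"
    and T :: nat and lam :: "int \<Rightarrow> 'l" and Psi :: "nat \<Rightarrow> 'a" and \<pi> :: 'l
  assumes A_alg: "K_algebra_acting K emb act"
    and deg_A: "\<exists>B. module_basis K (\<lambda>k \<alpha>. emb k * \<alpha>) UNIV B {..<p ^ n}"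
    and scaf: "scaffold K v act p n bs (enat T) lam Psi"
    and unif: "\<pi> \<in> K" "\<pi> \<noteq> 0" "v \<pi> = int (p ^ n)"
begin

abbreviation "\<AA> \<equiv> assoc_order v act h"
abbreviation "\<OO> \<equiv> valring K v"
abbreviation "\<Psi> \<equiv> PsiPow p n Psi"
abbreviation "\<Phi> \<equiv> Phi emb \<pi> p n bs h Psi"

lemma act_mult: "act (\<alpha> * \<beta>) x = act \<alpha> (act \<beta> x)"
  and act_one: "act 1 x = x"
  and act_add_left: "act (\<alpha> + \<beta>) x = act \<alpha> x + act \<beta> x"
  and act_add_right: "act \<alpha> (x + y) = act \<alpha> x + act \<alpha> y"
  and act_emb: "k \<in> K \<Longrightarrow> act (emb k) x = k * x"
  and emb_commute: "k \<in> K \<Longrightarrow> emb k * \<alpha> = \<alpha> * emb k"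
  and emb_add: "k \<in> K \<Longrightarrow> k' \<in> K \<Longrightarrow> emb (k + k') = emb k + emb k'"
  and emb_mult: "k \<in> K \<Longrightarrow> k' \<in> K \<Longrightarrow> emb (k * k') = emb k * emb k'"
  and emb_one: "emb 1 = 1"
  using A_alg unfolding K_algebra_acting_def by blast+

sublocale A: subfield_vector_space K "\<lambda>k \<alpha>. emb k * \<alpha>"
  by unfold_locales (simp_all add: K_sub emb_add emb_mult emb_one distrib_right distrib_left mult.assoc)

lemma act_zero_left: "act 0 x = 0"
  by (metis act_add_left add.right_neutral add_left_cancel)

lemma act_zero_right: "act \<alpha> 0 = 0"
  by (metis act_add_right add.right_neutral add_left_cancel)

lemma act_scale: "k \<in> K \<Longrightarrow> act \<alpha> (k * x) = k * act \<alpha> x"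
  by (metis act_mult act_emb emb_commute)

lemma act_emb_mult: "k \<in> K \<Longrightarrow> act (emb k * \<alpha>) x = k * act \<alpha> x"
  by (simp add: act_mult act_emb)

lemma act_sum_left: "act (sum f I) x = (\<Sum>i\<in>I. act (f i) x)"
  by (induction I rule: infinite_finite_induct) (auto simp: act_zero_left act_add_left)

lemma act_sum_right: "act \<alpha> (sum f I) = (\<Sum>i\<in>I. act \<alpha> (f i))"
  by (induction I rule: infinite_finite_induct) (auto simp: act_zero_right act_add_right)

lemma act_diff_right: "act \<alpha> (x - y) = act \<alpha> x - act \<alpha> y"
  using act_add_right[of \<alpha> "x - y" y] by simp

lemma act_combination:
  assumes "\<And>s. s < q \<Longrightarrow> c s \<in> K"
  shows "act (\<Sum>s<q. emb (c s) * f s) x = (\<Sum>s<q. c s * act (f s) x)"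
  unfolding act_sum_left using assms by (intro sum.cong) (auto simp: act_emb_mult)

lemma emb_eq_0: "k \<in> K \<Longrightarrow> emb k = 0 \<Longrightarrow> k = 0"
  using act_emb[of k 1] act_zero_left[of 1] by simp

lemma T_pos: "1 \<le> T"
  using scaf by (simp add: scaffold_def one_enat_def)

lemma lam: "lam t \<noteq> 0" "v (lam t) = t"
  using scaf by (auto simp: scaffold_def)

lemma lam_ratio:
  assumes "t mod int q = t' mod int q"
  obtains k where "k \<in> K" "k \<noteq> 0" "v k = t - t'" "lam t = k * lam t'"
proof
  let ?k = "lam t * inverse (lam t')"
  show "?k \<in> K" using scaf assms by (simp add: scaffold_def)
  show "?k \<noteq> 0" using lam by simp
  show "v ?k = t - t'" by (simp add: v_mult v_inverse lam)
  show "lam t = ?k * lam t'" by (simp add: lam)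
qed

lemma distinct_mod_lam: "distinct_mod (\<lambda>i. lam (m + int i))"
  unfolding distinct_mod_def lam
proof (intro conjI allI impI lam inj_onI)
  fix i j assume ij: "i \<in> {..<q}" "j \<in> {..<q}" and e: "(m + int i) mod int q = (m + int j) mod int q"
  have "int q dvd (m + int i) - (m + int j)" using e by (simp only: mod_eq_dvd_iff)
  then have "int q dvd int i - int j" by simp
  moreover have "int i < int q" "int j < int q" using ij by (simp_all del: of_nat_power)
  then have "\<bar>int i - int j\<bar> < int q" by linarith
  ultimately have "int i - int j = 0" using dvd_imp_le_int[of "int i - int j" "int q"] by linarith
  then show "i = j" by simp
qed

lemma lam_expansion:
  assumes "x \<in> \<PP> m"
  obtains c where "\<And>i. i < q \<Longrightarrow> c i \<in> \<OO>" "x = (\<Sum>i<q. c i * lam (m + int i))"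
proof -
  have "v (lam (m + int i)) < m + int q" if "i < q" for i using that by (simp add: lam)
  from expansion_in_window[OF distinct_mod_lam this assms] that show ?thesis by blast
qed

text \<open>The scaffold congruence for an operator of shift \<open>\<tau>\<close>; it is stable under composition.\<close>

definition approx :: "'a \<Rightarrow> int \<Rightarrow> (int \<Rightarrow> bool) \<Rightarrow> bool" where
  "approx \<alpha> \<tau> G \<longleftrightarrow> (\<forall>t. \<exists>u\<in>valunits K v.
     act \<alpha> (lam t) - (if G t then u else 0) * lam (t + \<tau>) \<in> \<PP> (t + \<tau> + int T))"

lemma valunits_closed: "x \<in> valunits K v \<Longrightarrow> y \<in> valunits K v \<Longrightarrow> x * y \<in> valunits K v"
  by (auto simp: valunits_def L.K_closed v_mult)

lemma one_valunits: "1 \<in> valunits K v"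
  by (simp add: valunits_def L.K_closed v_one)

lemma valunits_valring: "x \<in> valunits K v \<Longrightarrow> x \<in> \<OO>"
  by (auto simp: valunits_def valring_def)

text \<open>On \<open>lam t\<close> both the main term and the error lie in
  \<open>\<PP> (t + \<tau>)\<close>, and every \<open>x\<close> in \<open>\<PP> m\<close> is an
  integral combination of \<open>q\<close> consecutive \<open>lam\<close> starting at
  \<open>lam m\<close>.\<close>

lemma approx_raises_valuation:
  assumes "approx \<alpha> \<tau> G" "x \<in> \<PP> m"
  shows "act \<alpha> x \<in> \<PP> (m + \<tau>)"
proof -
  obtain c where c: "\<And>i. i < q \<Longrightarrow> c i \<in> \<OO>" "x = (\<Sum>i<q. c i * lam (m + int i))"
    using lam_expansion[OF assms(2)] by blast
  have lamP: "act \<alpha> (lam t) \<in> \<PP> (t + \<tau>)" for t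
  proof -
    obtain u where u: "u \<in> valunits K v"
      "act \<alpha> (lam t) - (if G t then u else 0) * lam (t + \<tau>) \<in> \<PP> (t + \<tau> + int T)"
      using assms(1) unfolding approx_def by blast
    have "(if G t then u else 0) \<in> \<OO>" using u(1) valunits_valring valring_closed by auto
    then have "(if G t then u else 0) * lam (t + \<tau>) \<in> \<PP> (t + \<tau>)"
      using valring_mult_P P_self[of "lam (t + \<tau>)"] lam by metis
    from P_add[OF P_mono[OF u(2)] this] show ?thesis by simp
  qed
  have "act \<alpha> x = (\<Sum>i<q. c i * act \<alpha> (lam (m + int i)))"
    unfolding c(2) act_sum_right using c(1) valring_K by (intro sum.cong) (auto simp: act_scale)
  moreover have "c i * act \<alpha> (lam (m + int i)) \<in> \<PP> (m + \<tau>)" if "i < q" for i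
    using c(1)[OF that] P_mono[OF lamP[of "m + int i"], of "m + \<tau>"] by (intro valring_mult_P) auto
  ultimately show ?thesis by (auto intro: P_sum)
qed

lemma approx_one: "approx 1 0 (\<lambda>_. True)"
  unfolding approx_def using one_valunits by (auto simp: act_one P_zero intro!: bexI[of _ 1])

text \<open>Composition costs no tolerance: \<open>\<beta>\<close> moves the error of
  \<open>\<alpha>\<close> by \<open>\<tau>'\<close>, and the error of \<open>\<beta>\<close> is only
  multiplied by an integral coefficient, so both stay \<open>T\<close> beyond the total
  shift.\<close>

lemma approx_mult:
  assumes \<alpha>: "approx \<alpha> \<tau> G" and \<beta>: "approx \<beta> \<tau>' H"
  shows "approx (\<beta> * \<alpha>) (\<tau> + \<tau>') (\<lambda>t. G t \<and> H (t + \<tau>))"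
  unfolding approx_def
proof
  fix t
  obtain u where u: "u \<in> valunits K v"
    "act \<alpha> (lam t) - (if G t then u else 0) * lam (t + \<tau>) \<in> \<PP> (t + \<tau> + int T)"
    using \<alpha> unfolding approx_def by blast
  obtain u' where u': "u' \<in> valunits K v"
    "act \<beta> (lam (t + \<tau>)) - (if H (t + \<tau>) then u' else 0) * lam (t + \<tau> + \<tau>') \<in> \<PP> (t + \<tau> + \<tau>' + int T)"
    using \<beta> unfolding approx_def by blast
  define g g' where "g = (if G t then u else 0)" and "g' = (if H (t + \<tau>) then u' else 0)"
  have g: "g \<in> \<OO>" unfolding g_def using u(1) valunits_valring valring_closed by auto
  have "act \<beta> (act \<alpha> (lam t) - g * lam (t + \<tau>)) \<in> \<PP> (t + \<tau> + int T + \<tau>')"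
    using u(2) unfolding g_def by (rule approx_raises_valuation[OF \<beta>])
  then have 1: "act \<beta> (act \<alpha> (lam t)) - g * act \<beta> (lam (t + \<tau>)) \<in> \<PP> (t + \<tau> + \<tau>' + int T)"
    using valring_K[OF g] by (simp add: act_diff_right act_scale algebra_simps)
  have 2: "g * (act \<beta> (lam (t + \<tau>)) - g' * lam (t + \<tau> + \<tau>')) \<in> \<PP> (t + \<tau> + \<tau>' + int T)"
    using u'(2) unfolding g'_def by (rule valring_mult_P[OF g])
  have "act (\<beta> * \<alpha>) (lam t) - (g * g') * lam (t + \<tau> + \<tau>') \<in> \<PP> (t + \<tau> + \<tau>' + int T)"
    using P_add[OF 1 2] by (simp add: act_mult algebra_simps)
  moreover have "g * g' = (if G t \<and> H (t + \<tau>) then u * u' else 0)" by (simp add: g_def g'_def)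
  ultimately show "\<exists>u\<in>valunits K v. act (\<beta> * \<alpha>) (lam t)
      - (if G t \<and> H (t + \<tau>) then u else 0) * lam (t + (\<tau> + \<tau>')) \<in> \<PP> (t + (\<tau> + \<tau>') + int T)"
    using valunits_closed[OF u(1) u'(1)] by (intro bexI[of _ "u * u'"]) (simp_all add: add.assoc)
qed

lemma approx_Psi:
  assumes "i \<in> {1..n}"
  shows "approx (Psi i) (\<sigma> i) (\<lambda>t. 1 \<le> digit_at t i)"
  unfolding approx_def
proof
  fix t
  have tol: "within_tol v (enat T) x (lam t') \<longleftrightarrow> x \<in> \<PP> (t' + int T)" for x t'
    by (simp add: within_tol_def Pideal_def lam)
  obtain u where u: "u \<in> valunits K v"
    "1 \<le> digit_at t i \<longrightarrow> act (Psi i) (lam t) - u * lam (t + \<sigma> i) \<in> \<PP> (t + \<sigma> i + int T)"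
    "digit_at t i = 0 \<longrightarrow> act (Psi i) (lam t) \<in> \<PP> (t + \<sigma> i + int T)"
    using scaf assms unfolding scaffold_def tol digit_at_def by blast
  then show "\<exists>u\<in>valunits K v. act (Psi i) (lam t) - (if 1 \<le> digit_at t i then u else 0) * lam (t + \<sigma> i)
      \<in> \<PP> (t + \<sigma> i + int T)"
    by (intro bexI[OF _ u(1)]) auto
qed

lemma approx_Psi_power:
  assumes i: "i \<in> {1..n}"
  shows "approx (Psi i ^ k) (int k * \<sigma> i) (\<lambda>t. k \<le> digit_at t i)"
proof (induction k)
  case 0
  then show ?case using approx_one by simp
next
  case (Suc k)
  \<comment> \<open>After \<open>k\<close> applications digit \<open>i\<close> has dropped by
    \<open>k\<close>, so one more survives exactly when the digit at \<open>t\<close> was at least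
    \<open>k + 1\<close>.\<close>
  have "(\<lambda>t. k \<le> digit_at t i \<and> 1 \<le> digit_at (t + int k * \<sigma> i) i) = (\<lambda>t. Suc k \<le> digit_at t i)"
    using digit_at_shift_mult(1)[OF i] by (intro ext) (metis Suc_leD Suc_le_eq One_nat_def zero_less_diff)
  moreover have "int k * \<sigma> i + \<sigma> i = int (Suc k) * \<sigma> i" by (simp add: algebra_simps)
  ultimately show ?case using approx_mult[OF Suc approx_Psi[OF i]] by simp
qed

text \<open>Rightmost factors act first, so the product is built up from the power of
  \<open>Psi 1\<close> by prepending that of \<open>Psi (m + 1)\<close>; its guard is evaluated
  after shifts that leave digit \<open>m + 1\<close> alone.\<close>

lemma approx_PsiPow: "approx (\<Psi> s) (\<bb> s) (\<lambda>t. \<forall>i\<in>{1..n}. digit p s (n - i) \<le> digit_at t i)"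
proof -
  have "approx (prod_list (map (\<lambda>i. Psi i ^ digit p s (n - i)) (rev [1..<m + 1])))
      (\<Sum>i=1..m. int (digit p s (n - i)) * \<sigma> i) (\<lambda>t. \<forall>i\<in>{1..m}. digit p s (n - i) \<le> digit_at t i)"
    if "m \<le> n" for m
    using that
  proof (induction m)
    case 0
    then show ?case using approx_one by simp
  next
    case (Suc m)
    let ?k = "digit p s (n - Suc m)"
    let ?t = "\<lambda>t. t + (\<Sum>i=1..m. int (digit p s (n - i)) * \<sigma> i)"
    have "((\<forall>i\<in>{1..m}. digit p s (n - i) \<le> digit_at t i) \<and> ?k \<le> digit_at (?t t) (Suc m)) \<longleftrightarrow>
       (\<forall>i\<in>{1..Suc m}. digit p s (n - i) \<le> digit_at t i)" for t
      using digit_at_shift_sum[of m "\<lambda>i. digit p s (n - i)" t "Suc m"] Suc.prems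
      by (auto simp: atLeastAtMostSuc_conv)
    moreover have "approx (Psi (Suc m) ^ ?k * prod_list (map (\<lambda>i. Psi i ^ digit p s (n - i)) (rev [1..<m + 1])))
      ((\<Sum>i=1..m. int (digit p s (n - i)) * \<sigma> i) + int ?k * \<sigma> (Suc m))
      (\<lambda>t. (\<forall>i\<in>{1..m}. digit p s (n - i) \<le> digit_at t i) \<and> ?k \<le> digit_at (?t t) (Suc m))"
      using Suc by (intro approx_mult approx_Psi_power) auto
    ultimately show ?case by simp
  qed
  from this[of n] show ?thesis by (simp add: PsiPow_def bfrak_def mult.assoc)
qed

section \<open>The window basis and the action of \<open>\<Phi>\<close> on it\<close>

definition e :: "nat \<Rightarrow> 'l" where
  "e r = lam (b + \<bb> r - int q * d r)"

lemma e: "e r \<noteq> 0" "v (e r) = b + \<bb> r - int q * d r" "h \<le> v (e r)" "v (e r) < h + int q"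
  unfolding e_def lam using dfun_bounds[of r] by (simp_all add: lam)

lemma e_in_P: "e r \<in> \<PP> h"
  using e(3) by (simp add: Pideal_def)

text \<open>Modulo \<open>q\<close> only \<open>b + \<bb> s\<close> remains, and
  \<open>\<bb>\<close> is injective there. The case \<open>k = d\<close> serves the basis
  \<open>e\<close>, the case \<open>k = w\<close> the values of \<open>\<Phi> s\<close> at an
  element of valuation \<open>b\<close>.\<close>

lemma distinct_mod_bfrak:
  assumes "\<And>s. s < q \<Longrightarrow> y s \<noteq> 0" "\<And>s. s < q \<Longrightarrow> v (y s) = b + \<bb> s - int q * k s"
  shows "distinct_mod y"
  unfolding distinct_mod_def
proof (intro conjI allI impI assms(1) inj_onI)
  fix s r assume "s \<in> {..<q}" "r \<in> {..<q}" and eq: "v (y s) mod int q = v (y r) mod int q"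
  then have s: "s < q" and r: "r < q" by auto
  have "int q dvd (b + \<bb> s - int q * k s) - (b + \<bb> r - int q * k r)"
    using eq assms(2)[OF s] assms(2)[OF r] by (metis mod_eq_dvd_iff)
  also have "(b + \<bb> s - int q * k s) - (b + \<bb> r - int q * k r) = (\<bb> s - \<bb> r) + int q * (k r - k s)"
    by (simp only: right_diff_distrib)
  finally have "int q dvd \<bb> s - \<bb> r" using dvd_add_left_iff dvd_triv_left by blast
  then show "s = r" using bfrak_inj[OF s r] by (simp only: mod_eq_dvd_iff)
qed

lemma distinct_mod_e: "distinct_mod e"
  using e(1,2) by (intro distinct_mod_bfrak[where k = d])

lemma e_expansion:
  assumes "x \<in> \<PP> h"
  obtains c where "\<And>r. r < q \<Longrightarrow> c r \<in> \<OO>" "x = (\<Sum>r<q. c r * e r)"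
  using expansion_in_window[OF distinct_mod_e e(4) assms] by blast

lemma pi_powi: "\<pi> powi k \<in> K" "\<pi> powi k \<noteq> 0" "v (\<pi> powi k) = k * int q"
proof -
  have "\<pi> ^ m \<in> K" for m using unif L.K_closed by (induction m) auto
  then show "\<pi> powi k \<in> K" using L.K_closed by (auto simp: power_int_def power_inverse)
  show "\<pi> powi k \<noteq> 0" using unif by simp
  show "v (\<pi> powi k) = k * int q" using v_powi unif by simp
qed

lemma act_Phi: "act (\<Phi> s) x = \<pi> powi (- w s) * act (\<Psi> s) x"
  unfolding Phi_def using pi_powi by (simp add: act_emb_mult)

lemma pi_powi_mult_P: "x \<in> \<PP> m \<Longrightarrow> \<pi> powi (- k) * x \<in> \<PP> (m - int q * k)"
  using P_mult[OF P_self[of "\<pi> powi (- k)"], of x m] pi_powi(3)[of "- k"] by (simp add: algebra_simps)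

lemma Phi_e:
  assumes s: "s < q" and r: "r < q"
  shows "\<exists>k\<in>K. (no_carry p n s r \<longrightarrow> k \<noteq> 0 \<and> v k = int q * (d (r + s) - d r - w s)) \<and>
    (\<not> no_carry p n s r \<longrightarrow> k = 0) \<and> act (\<Phi> s) (e r) - k * e (r + s) \<in> \<PP> (h + int T - (b - h))"
proof -
  define t where "t = b + \<bb> r - int q * d r"
  \<comment> \<open>Scaled by \<open>\<pi> powi (- w s)\<close>, the error starts \<open>T\<close>
    beyond \<open>t + \<bb> s - q * w s\<close>. This is at least \<open>h + (h - b)\<close>,
    because \<open>w s \<le> d s\<close> and both \<open>t\<close> and
    \<open>b + \<bb> s - q * d s\<close> are at least \<open>h\<close>.\<close>
  have le: "h + int T - (b - h) \<le> t + \<bb> s + int T - int q * w s"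
  proof -
    have "h \<le> b + \<bb> s - int q * d s" by (rule dfun_bounds)
    moreover have "int q * w s \<le> int q * d s" using wfun_le_dfun[OF s] by (intro mult_left_mono) auto
    moreover have "h \<le> t" unfolding t_def by (rule dfun_bounds)
    ultimately show ?thesis by linarith
  qed
  obtain u where u: "u \<in> valunits K v"
    "act (\<Psi> s) (lam t) - (if no_carry p n s r then u else 0) * lam (t + \<bb> s) \<in> \<PP> (t + \<bb> s + int T)"
    using approx_PsiPow[of s] unfolding approx_def no_carry_iff_digit_at[OF r, of s "d r"] t_def by blast
  from pi_powi_mult_P[OF this(2), of "w s"]
  have main: "act (\<Phi> s) (e r) - \<pi> powi (- w s) * (if no_carry p n s r then u else 0) * lam (t + \<bb> s)
      \<in> \<PP> (h + int T - (b - h))"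
    using P_mono[OF _ le] unfolding e_def t_def[symmetric] act_Phi by (simp only: right_diff_distrib mult.assoc)
  show ?thesis
  proof (cases "no_carry p n s r")
    case False
    then show ?thesis using main by (intro bexI[of _ 0]) (auto simp: L.K_closed)
  next
    case True
    have add: "\<bb> (r + s) = \<bb> s + \<bb> r" using bfrak_add[OF s r True] by (simp add: add.commute)
    define t' where "t' = b + \<bb> (r + s) - int q * d (r + s)"
    have diff: "t + \<bb> s - t' = int q * (d (r + s) - d r)"
      unfolding t_def t'_def add by (simp only: right_diff_distrib)
    \<comment> \<open>The indices being congruent modulo \<open>q\<close>, the two
      \<open>lam\<close> differ by a scalar in \<open>K\<close>, which enters the required
      coefficient.\<close>
    then have "(t + \<bb> s) mod int q = t' mod int q" by (simp add: mod_eq_dvd_iff)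
    then obtain k where k: "k \<in> K" "k \<noteq> 0" "v k = t + \<bb> s - t'" "lam (t + \<bb> s) = k * lam t'"
      by (rule lam_ratio)
    define c where "c = \<pi> powi (- w s) * u * k"
    have uK: "u \<in> K" "u \<noteq> 0" "v u = 0" using u(1) by (auto simp: valunits_def)
    have "c \<in> K" unfolding c_def using pi_powi uK k L.K_closed by auto
    moreover have "c \<noteq> 0" unfolding c_def using pi_powi uK k by auto
    moreover have "v c = int q * (d (r + s) - d r - w s)"
      unfolding c_def using pi_powi[of "- w s"] uK k(2,3) diff by (simp add: v_mult right_diff_distrib)
    moreover have "act (\<Phi> s) (e r) - c * e (r + s) \<in> \<PP> (h + int T - (b - h))"
      using main True unfolding k(4) c_def e_def t'_def by (simp add: mult.assoc)
    ultimately show ?thesis using True by blast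
  qed
qed

text \<open>A chosen leading coefficient of \<open>\<Phi> s\<close> on \<open>e r\<close>. It is
  zero when the addition carries, in particular whenever \<open>r + s\<close> reaches
  \<open>q\<close>.\<close>

definition \<kappa> :: "nat \<Rightarrow> nat \<Rightarrow> 'l" where
  "\<kappa> s r = (SOME k. k \<in> K \<and>
     (no_carry p n s r \<longrightarrow> k \<noteq> 0 \<and> v k = int q * (d (r + s) - d r - w s)) \<and>
     (\<not> no_carry p n s r \<longrightarrow> k = 0) \<and> act (\<Phi> s) (e r) - k * e (r + s) \<in> \<PP> (h + int T - (b - h)))"

lemma \<kappa>:
  assumes "s < q" "r < q"
  shows "\<kappa> s r \<in> K" "no_carry p n s r \<Longrightarrow> \<kappa> s r \<noteq> 0"
    "no_carry p n s r \<Longrightarrow> v (\<kappa> s r) = int q * (d (r + s) - d r - w s)"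
    "\<not> no_carry p n s r \<Longrightarrow> \<kappa> s r = 0"
    "act (\<Phi> s) (e r) - \<kappa> s r * e (r + s) \<in> \<PP> (h + int T - (b - h))"
proof -
  have "\<exists>k. k \<in> K \<and>
     (no_carry p n s r \<longrightarrow> k \<noteq> 0 \<and> v k = int q * (d (r + s) - d r - w s)) \<and>
     (\<not> no_carry p n s r \<longrightarrow> k = 0) \<and> act (\<Phi> s) (e r) - k * e (r + s) \<in> \<PP> (h + int T - (b - h))"
    using Phi_e[OF assms] by blast
  from someI_ex[OF this] show "\<kappa> s r \<in> K" "no_carry p n s r \<Longrightarrow> \<kappa> s r \<noteq> 0"
    "no_carry p n s r \<Longrightarrow> v (\<kappa> s r) = int q * (d (r + s) - d r - w s)"
    "\<not> no_carry p n s r \<Longrightarrow> \<kappa> s r = 0"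
    "act (\<Phi> s) (e r) - \<kappa> s r * e (r + s) \<in> \<PP> (h + int T - (b - h))"
    unfolding \<kappa>_def[symmetric] by auto
qed

text \<open>This is what the minimum in \<open>w s\<close> is for: no carry-free \<open>r\<close>
  makes \<open>d (r + s) - d r - w s\<close> negative.\<close>

lemma \<kappa>_valring:
  assumes "s < q" "r < q"
  shows "\<kappa> s r \<in> \<OO>"
proof (cases "no_carry p n s r")
  case True
  have "0 \<le> int q * (d (r + s) - d r - w s)" using wfun_le[OF assms True] by simp
  then show ?thesis using \<kappa>[OF assms] True by (simp add: valring_def)
qed (use \<kappa>[OF assms] valring_closed in auto)

text \<open>In consecutive \<open>lam\<close>, the coefficient of \<open>lam b\<close> in
  \<open>\<rho>\<close> is a unit and the rest has larger valuation. \<open>\<Psi> s\<close> keeps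
  the rest above the leading term, and tolerance at least 1 does the same for the error.\<close>

lemma Phi_rho:
  assumes \<rho>: "\<rho> \<noteq> 0" "v \<rho> = b" and s: "s < q"
  shows "act (\<Phi> s) \<rho> \<noteq> 0" "v (act (\<Phi> s) \<rho>) = b + \<bb> s - int q * w s"
proof -
  have "\<rho> \<in> \<PP> b" using \<rho> by (simp add: Pideal_def)
  then obtain c where c: "\<And>i. i < q \<Longrightarrow> c i \<in> \<OO>" "\<rho> = (\<Sum>i<q. c i * lam (b + int i))"
    using lam_expansion by blast
  define \<rho>' where "\<rho>' = (\<Sum>i\<in>{..<q} - {0}. c i * lam (b + int i))"
  have eq: "\<rho> = c 0 * lam b + \<rho>'"
    unfolding c(2) \<rho>'_def using q_pos sum.remove[of "{..<q}" 0 "\<lambda>i. c i * lam (b + int i)"] by simp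
  have \<rho>'P: "\<rho>' \<in> \<PP> (b + 1)"
    unfolding \<rho>'_def
  proof (rule P_sum)
    fix i assume "i \<in> {..<q} - {0}"
    then show "c i * lam (b + int i) \<in> \<PP> (b + 1)"
      using c(1) by (intro valring_mult_P) (auto simp: Pideal_def lam)
  qed
  have "c 0 * lam b - \<rho> \<in> \<PP> (v \<rho> + 1)" using P_uminus[OF \<rho>'P] eq \<rho>(2) by simp
  from v_eqI[OF \<rho>(1) this] have c0: "c 0 \<noteq> 0" "v (c 0) = 0" using \<rho>(2) by (auto simp: v_mult lam)
  have c0O: "c 0 \<in> \<OO>" using c(1) q_pos by simp
  \<comment> \<open>All digits of \<open>\<aa> b = q - 1\<close> are maximal, so no
    \<open>\<Psi> s\<close> loses its main term at \<open>lam b\<close>; formally this is the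
    no-carry criterion for \<open>r = 0\<close>.\<close>
  have guard: "\<forall>i\<in>{1..n}. digit p s (n - i) \<le> digit_at b i"
    using no_carry_iff_digit_at[OF q_pos, of s 0] no_carry_0 by simp
  obtain u where u: "u \<in> valunits K v"
    "act (\<Psi> s) (lam b) - (if \<forall>i\<in>{1..n}. digit p s (n - i) \<le> digit_at b i then u else 0) * lam (b + \<bb> s)
      \<in> \<PP> (b + \<bb> s + int T)"
    using approx_PsiPow[of s] unfolding approx_def by blast
  have u2: "act (\<Psi> s) (lam b) - u * lam (b + \<bb> s) \<in> \<PP> (b + \<bb> s + int T)"
    using u(2) guard by simp
  have uK: "u \<noteq> 0" "v u = 0" using u(1) by (auto simp: valunits_def)
  let ?y = "c 0 * u * lam (b + \<bb> s)"
  have y: "?y \<noteq> 0" "v ?y = b + \<bb> s" using c0 uK lam by (auto simp: v_mult)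
  have "c 0 * (act (\<Psi> s) (lam b) - u * lam (b + \<bb> s)) \<in> \<PP> (b + \<bb> s + 1)"
    using P_mono[OF u2] T_pos by (intro valring_mult_P[OF c0O]) simp
  moreover have "act (\<Psi> s) \<rho>' \<in> \<PP> (b + \<bb> s + 1)"
    using approx_raises_valuation[OF approx_PsiPow \<rho>'P, of s] by (simp add: algebra_simps)
  ultimately have "c 0 * (act (\<Psi> s) (lam b) - u * lam (b + \<bb> s)) + act (\<Psi> s) \<rho>' \<in> \<PP> (v ?y + 1)"
    unfolding y(2) by (rule P_add)
  moreover have "act (\<Psi> s) \<rho> - ?y = c 0 * (act (\<Psi> s) (lam b) - u * lam (b + \<bb> s)) + act (\<Psi> s) \<rho>'"
    unfolding eq act_add_right using valring_K[OF c0O] by (simp add: act_scale algebra_simps)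
  ultimately have "act (\<Psi> s) \<rho> - ?y \<in> \<PP> (v ?y + 1)" by simp
  from v_eqI[OF y(1) this] have "act (\<Psi> s) \<rho> \<noteq> 0" "v (act (\<Psi> s) \<rho>) = b + \<bb> s" using y(2) by auto
  then show "act (\<Phi> s) \<rho> \<noteq> 0" "v (act (\<Phi> s) \<rho>) = b + \<bb> s - int q * w s"
    unfolding act_Phi using pi_powi[of "- w s"] by (auto simp: v_mult)
qed

lemma distinct_mod_Phi_rho:
  assumes "\<rho> \<noteq> 0" "v \<rho> = b"
  shows "distinct_mod (\<lambda>s. act (\<Phi> s) \<rho>)"
  using Phi_rho[OF assms] by (intro distinct_mod_bfrak[where k = w])

text \<open>Evaluation at \<open>lam b\<close> turns a relation between operators into one between
  elements with valuations distinct modulo \<open>q\<close>.\<close>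

lemma Phi_independent:
  assumes "\<forall>s<q. c s \<in> K" "(\<Sum>s<q. emb (c s) * \<Phi> s) = 0"
  shows "\<forall>s<q. c s = 0"
proof -
  have "(\<Sum>s<q. c s * act (\<Phi> s) (lam b)) = act (\<Sum>s<q. emb (c s) * \<Phi> s) (lam b)"
    using assms(1) by (intro act_combination[symmetric]) auto
  then have "(\<Sum>s<q. c s * act (\<Phi> s) (lam b)) = 0" unfolding assms(2) act_zero_left .
  then show ?thesis
    using distinct_mod_independent[OF distinct_mod_Phi_rho assms(1)] lam by blast
qed

lemma Phi_basis: "module_basis K (\<lambda>k \<alpha>. emb k * \<alpha>) UNIV \<Phi> {..<q}"
proof -
  obtain B where "module_basis K (\<lambda>k \<alpha>. emb k * \<alpha>) UNIV B {..<q}" using deg_A by blast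
  then show ?thesis by (rule A.independent_imp_basis) (rule Phi_independent)
qed

section \<open>Integral bases of the associated order\<close>

lemma order_combination:
  assumes "\<And>s. s < q \<Longrightarrow> \<Phi> s \<in> \<AA>" "\<And>s. s < q \<Longrightarrow> c s \<in> \<OO>"
  shows "(\<Sum>s<q. emb (c s) * \<Phi> s) \<in> \<AA>"
  unfolding assoc_order_def
proof (intro CollectI ballI)
  fix x assume x: "x \<in> \<PP> h"
  have "act (\<Sum>s<q. emb (c s) * \<Phi> s) x = (\<Sum>s<q. c s * act (\<Phi> s) x)"
    using assms(2) valring_K by (intro act_combination) blast
  also have "\<dots> \<in> \<PP> h"
    using assms x by (intro P_sum valring_mult_P) (auto simp: assoc_order_def)
  finally show "act (\<Sum>s<q. emb (c s) * \<Phi> s) x \<in> \<PP> h" .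
qed

text \<open>The \<open>\<Phi> s\<close> already form a \<open>K\<close>-basis of the algebra, so
  only membership and integrality of coordinates remain.\<close>

lemma order_basisI:
  assumes Phi: "\<And>s. s < q \<Longrightarrow> \<Phi> s \<in> \<AA>"
    and integral: "\<And>c. (\<And>s. s < q \<Longrightarrow> c s \<in> K) \<Longrightarrow> (\<Sum>s<q. emb (c s) * \<Phi> s) \<in> \<AA> \<Longrightarrow> \<forall>s<q. c s \<in> \<OO>"
  shows "module_basis \<OO> (\<lambda>k \<alpha>. emb k * \<alpha>) \<AA> \<Phi> {..<q}"
  unfolding module_basis_def
proof (intro conjI ballI allI impI)
  fix \<alpha> assume \<alpha>: "\<alpha> \<in> \<AA>"
  obtain c where "\<forall>s\<in>{..<q}. c s \<in> K" "\<alpha> = (\<Sum>s<q. emb (c s) * \<Phi> s)"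
    using Phi_basis unfolding module_basis_def by blast
  then show "\<exists>c. (\<forall>s\<in>{..<q}. c s \<in> \<OO>) \<and> \<alpha> = (\<Sum>s<q. emb (c s) * \<Phi> s)"
    using integral[of c] \<alpha> by blast
next
  fix c s assume "(\<forall>s\<in>{..<q}. c s \<in> \<OO>) \<and> (\<Sum>s<q. emb (c s) * \<Phi> s) = 0" "s \<in> {..<q}"
  then show "c s = 0" using Phi_independent[of c] valring_K by blast
qed (use Phi in auto)

text \<open>The main terms are integral multiples of window elements, and the error exponent
  \<open>h + T - (b - h)\<close> is at least \<open>h\<close>.\<close>

lemma Phi_in_order:
  assumes T: "b - h \<le> int T" and s: "s < q"
  shows "\<Phi> s \<in> \<AA>"
  unfolding assoc_order_def
proof (intro CollectI ballI)
  fix x assume "x \<in> \<PP> h"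
  then obtain c where c: "\<And>r. r < q \<Longrightarrow> c r \<in> \<OO>" "x = (\<Sum>r<q. c r * e r)"
    using e_expansion by blast
  have "act (\<Phi> s) (e r) \<in> \<PP> h" if r: "r < q" for r
  proof -
    have "\<kappa> s r * e (r + s) \<in> \<PP> h" using \<kappa>_valring[OF s r] e_in_P by (rule valring_mult_P)
    moreover have "act (\<Phi> s) (e r) - \<kappa> s r * e (r + s) \<in> \<PP> h"
      using \<kappa>(5)[OF s r] T by (rule_tac P_mono) auto
    ultimately show ?thesis using P_add by fastforce
  qed
  moreover have "act (\<Phi> s) x = (\<Sum>r<q. c r * act (\<Phi> s) (e r))"
    unfolding c(2) act_sum_right using c(1) valring_K by (intro sum.cong) (auto simp: act_scale)
  ultimately show "act (\<Phi> s) x \<in> \<PP> h"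
    using c(1) by (auto intro!: P_sum valring_mult_P)
qed

text \<open>With \<open>w = d\<close> the elements \<open>act (\<Phi> s) \<rho>\<close> have
  valuations in the window, so elements of \<open>\<PP> h\<close> expand in them with coefficients
  in \<open>\<OO>\<close>. This yields the basis and surjectivity of evaluation at
  \<open>\<rho>\<close>; independence makes the evaluation injective on
  \<open>\<AA>\<close>.\<close>

lemma free_of_wfun_eq_dfun:
  assumes Phi: "\<And>s. s < q \<Longrightarrow> \<Phi> s \<in> \<AA>" and wd: "\<forall>s<q. w s = d s" and \<rho>: "\<rho> \<noteq> 0" "v \<rho> = b"
  shows "module_basis \<OO> (\<lambda>k \<alpha>. emb k * \<alpha>) \<AA> \<Phi> {..<q}"
    and "(\<lambda>\<alpha>. act \<alpha> \<rho>) ` \<AA> = \<PP> h"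
    and "free_module \<AA> act (\<PP> h)"
proof -
  let ?y = "\<lambda>s. act (\<Phi> s) \<rho>"
  have y: "distinct_mod ?y" by (rule distinct_mod_Phi_rho[OF \<rho>])
  have vy: "?y s \<noteq> 0" "v (?y s) < h + int q" if "s < q" for s
    using Phi_rho[OF \<rho> that] wd that dfun_bounds[of s] by auto
  have \<rho>P: "\<rho> \<in> \<PP> h" using \<rho> bpt(1) by (simp add: Pideal_def)
  show basis: "module_basis \<OO> (\<lambda>k \<alpha>. emb k * \<alpha>) \<AA> \<Phi> {..<q}"
  proof (rule order_basisI[OF Phi])
    fix c assume c: "\<And>s. s < q \<Longrightarrow> c s \<in> K" and "(\<Sum>s<q. emb (c s) * \<Phi> s) \<in> \<AA>"
    then have "act (\<Sum>s<q. emb (c s) * \<Phi> s) \<rho> \<in> \<PP> h" using \<rho>P by (simp add: assoc_order_def)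
    then have "(\<Sum>s<q. c s * ?y s) \<in> \<PP> h" using act_combination[OF c] by simp
    then have "c s * ?y s \<in> \<PP> h" if "s < q" for s
      using distinct_mod_terms[OF y _ _ that] c by blast
    then show "\<forall>s<q. c s \<in> \<OO>" using K_mult_in_P c vy by blast
  qed
  show image: "(\<lambda>\<alpha>. act \<alpha> \<rho>) ` \<AA> = \<PP> h"
  proof
    show "(\<lambda>\<alpha>. act \<alpha> \<rho>) ` \<AA> \<subseteq> \<PP> h" using \<rho>P by (auto simp: assoc_order_def)
    show "\<PP> h \<subseteq> (\<lambda>\<alpha>. act \<alpha> \<rho>) ` \<AA>"
    proof
      fix x assume "x \<in> \<PP> h"
      then obtain c where c: "\<And>s. s < q \<Longrightarrow> c s \<in> \<OO>" "x = (\<Sum>s<q. c s * ?y s)"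
        using expansion_in_window[OF y vy(2)] by blast
      then have "x = act (\<Sum>s<q. emb (c s) * \<Phi> s) \<rho>"
        using act_combination[of c] valring_K by simp
      moreover have "(\<Sum>s<q. emb (c s) * \<Phi> s) \<in> \<AA>" using Phi c(1) by (intro order_combination) auto
      ultimately show "x \<in> (\<lambda>\<alpha>. act \<alpha> \<rho>) ` \<AA>" by blast
    qed
  qed
  have inj: "\<alpha> = 0" if "\<alpha> \<in> \<AA>" "act \<alpha> \<rho> = 0" for \<alpha>
  proof -
    obtain c where c: "\<forall>s\<in>{..<q}. c s \<in> \<OO>" "\<alpha> = (\<Sum>s<q. emb (c s) * \<Phi> s)"
      using basis \<open>\<alpha> \<in> \<AA>\<close> unfolding module_basis_def by blast
    then have cK: "\<forall>s<q. c s \<in> K" using valring_K by blast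
    then have "(\<Sum>s<q. c s * ?y s) = 0" using act_combination[of c] that(2) c(2) by simp
    then have "\<forall>s<q. c s = 0" using distinct_mod_independent[OF y cK] by blast
    moreover have "emb 0 = 0" using A.smul_zero_left[of 1] by simp
    ultimately show ?thesis unfolding c(2) by (intro sum.neutral) simp
  qed
  show "free_module \<AA> act (\<PP> h)"
    unfolding free_module_def
  proof (intro exI[of _ "{\<rho>}"] conjI ballI allI impI)
    fix x assume "x \<in> \<PP> h"
    then obtain \<alpha> where \<alpha>: "\<alpha> \<in> \<AA>" "x = act \<alpha> \<rho>" using image by blast
    have "x = (\<Sum>f\<in>{f \<in> {\<rho>}. \<alpha> \<noteq> 0}. act \<alpha> f)"
      using \<alpha>(2) act_zero_left by (cases "\<alpha> = 0") auto
    then show "\<exists>c. finite {e \<in> {\<rho>}. c e \<noteq> 0} \<and> (\<forall>e\<in>{\<rho>}. c e \<in> \<AA>) \<and>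
        x = (\<Sum>e\<in>{e \<in> {\<rho>}. c e \<noteq> 0}. act (c e) e)"
      using \<alpha>(1) by (intro exI[of _ "\<lambda>_. \<alpha>"]) auto
  next
    fix c f assume c: "finite {e \<in> {\<rho>}. c e \<noteq> 0} \<and> (\<forall>e\<in>{\<rho>}. c e \<in> \<AA>) \<and>
        (\<Sum>e\<in>{e \<in> {\<rho>}. c e \<noteq> 0}. act (c e) e) = 0" and f: "f \<in> {\<rho>}"
    show "c f = 0"
    proof (rule ccontr)
      assume "c f \<noteq> 0"
      then have "{e \<in> {\<rho>}. c e \<noteq> 0} = {\<rho>}" using f by auto
      then have "act (c \<rho>) \<rho> = 0" using c by simp
      then show False using inj[of "c \<rho>"] c f \<open>c f \<noteq> 0\<close> by auto
    qed
  qed (use \<rho>P in auto)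
qed

lemma order_basis_strong:
  assumes T: "int q + b - h \<le> int T"
  shows "module_basis \<OO> (\<lambda>k \<alpha>. emb k * \<alpha>) \<AA> \<Phi> {..<q}"
proof (rule order_basisI)
  have "b - h \<le> int T" using T q_pos by linarith
  then show "\<Phi> s \<in> \<AA>" if "s < q" for s using that by (rule Phi_in_order)
next
  fix c assume c: "\<And>s. s < q \<Longrightarrow> c s \<in> K" and \<alpha>: "(\<Sum>s<q. emb (c s) * \<Phi> s) \<in> \<AA>"
  show "\<forall>s<q. c s \<in> \<OO>"
  proof (rule ccontr)
    assume "\<not> (\<forall>s<q. c s \<in> \<OO>)"
    then obtain s0 where s0: "s0 < q" "c s0 \<noteq> 0" "v (c s0) < 0" using c by (auto simp: valring_def)
    let ?N = "{s. s < q \<and> c s \<noteq> 0}"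
    \<comment> \<open>A nonzero coefficient of least valuation: this valuation is negative, hence at
      most \<open>- q\<close>.\<close>
    define s where "s = arg_min_on (\<lambda>s. v (c s)) ?N"
    have s: "s \<in> ?N" "\<And>j. j \<in> ?N \<Longrightarrow> v (c s) \<le> v (c j)"
    proof -
      have "finite ?N" "s0 \<in> ?N" using s0 by auto
      then show "s \<in> ?N" "\<And>j. j \<in> ?N \<Longrightarrow> v (c s) \<le> v (c j)"
        using arg_min_if_finite[of ?N "\<lambda>s. v (c s)"] unfolding s_def[symmetric] by (blast, force)
    qed
    define m where "m = v (c s)"
    have "m < 0" using s(2)[of s0] s0 unfolding m_def by auto
    moreover have "m mod int q = 0" unfolding m_def using v_K c s(1) by blast
    then have "int q dvd - m" by (simp only: dvd_minus_iff mod_eq_0_iff_dvd)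
    ultimately have m: "m + int q \<le> 0" using zdvd_imp_le[of "int q" "- m"] by linarith
    \<comment> \<open>At this \<open>r\<close> the coefficient \<open>\<kappa> s r\<close> has
      valuation 0, so term \<open>s\<close> keeps valuation
      \<open>m + v (e (r + s))\<close>.\<close>
    obtain r where r: "r < q" "no_carry p n s r" "w s = d (r + s) - d r"
      using wfun_attained s(1) by blast
    let ?x = "\<lambda>j. c j * \<kappa> j r * e (r + j)"
    have "c j * (act (\<Phi> j) (e r) - \<kappa> j r * e (r + j)) \<in> \<PP> (m + (h + int q))" if j: "j < q" for j
    proof (rule P_mult)
      show "c j \<in> \<PP> m" using s(2)[of j] j unfolding m_def by (auto simp: Pideal_def)
      show "act (\<Phi> j) (e r) - \<kappa> j r * e (r + j) \<in> \<PP> (h + int q)"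
        using \<kappa>(5)[OF j r(1)] by (rule P_mono) (use T in linarith)
    qed
    then have "(\<Sum>j<q. c j * (act (\<Phi> j) (e r) - \<kappa> j r * e (r + j))) \<in> \<PP> (m + (h + int q))"
      by (intro P_sum) auto
    then have 1: "(\<Sum>j<q. c j * act (\<Phi> j) (e r)) - (\<Sum>j<q. ?x j) \<in> \<PP> (m + (h + int q))"
      by (simp add: sum_subtractf right_diff_distrib mult.assoc)
    have "act (\<Sum>s<q. emb (c s) * \<Phi> s) (e r) \<in> \<PP> h" using \<alpha> e_in_P by (simp add: assoc_order_def)
    then have "(\<Sum>j<q. c j * act (\<Phi> j) (e r)) \<in> \<PP> h" using act_combination[OF c] by simp
    \<comment> \<open>Because \<open>m + q \<le> 0\<close>, the ideal \<open>\<PP> h\<close> is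
      contained in the one absorbing the errors.\<close>
    then have 2: "(\<Sum>j<q. c j * act (\<Phi> j) (e r)) \<in> \<PP> (m + (h + int q))"
      by (rule P_mono) (use m in linarith)
    have x: "(\<Sum>j<q. ?x j) \<in> \<PP> (m + (h + int q))" using P_diff[OF 2 1] by simp
    \<comment> \<open>With \<open>r\<close> fixed, nonzero terms are carry-free, so the indices
      \<open>r + j\<close> are distinct and below \<open>q\<close>, and \<open>e\<close> separates
      them modulo \<open>q\<close>.\<close>
    have inj: "inj_on (\<lambda>j. v (?x j)) {j\<in>{..<q}. ?x j \<noteq> 0}"
    proof (rule inj_onI)
      have *: "r + j < q \<and> v (?x j) mod int q = v (e (r + j)) mod int q" if "j \<in> {j\<in>{..<q}. ?x j \<noteq> 0}" for j
      proof -
        have j: "j < q" "c j \<noteq> 0" "\<kappa> j r \<noteq> 0" using that by auto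
        then have "no_carry p n j r" using \<kappa>(4) r(1) by blast
        then have "r + j < q" using digit_add(1)[OF j(1) r(1)] by (simp add: add.commute)
        moreover have "c j * \<kappa> j r \<in> K" "c j * \<kappa> j r \<noteq> 0" using c \<kappa>(1) j r(1) L.K_closed by auto
        then have "v (c j * \<kappa> j r) mod int q = 0" by (rule v_K)
        then have "(v (c j * \<kappa> j r) + v (e (r + j))) mod int q = v (e (r + j)) mod int q"
          by (metis add_0 mod_add_left_eq)
        then have "v (?x j) mod int q = v (e (r + j)) mod int q"
          unfolding v_mult[OF \<open>c j * \<kappa> j r \<noteq> 0\<close> e(1)] .
        ultimately show ?thesis by blast
      qed
      fix i j assume i: "i \<in> {j\<in>{..<q}. ?x j \<noteq> 0}" and j: "j \<in> {j\<in>{..<q}. ?x j \<noteq> 0}"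
        and eq: "v (?x i) = v (?x j)"
      have "inj_on (\<lambda>i. v (e i) mod int q) {..<q}" using distinct_mod_e unfolding distinct_mod_def ..
      moreover have "v (e (r + i)) mod int q = v (e (r + j)) mod int q"
        using *[OF i] *[OF j] eq by (simp del: of_nat_power)
      ultimately have "r + i = r + j" using *[OF i] *[OF j] by (blast dest: inj_onD)
      then show "i = j" by simp
    qed
    have "?x s \<in> \<PP> (m + (h + int q))"
      using sum_distinct_valuations[OF finite_lessThan inj x] s(1) by simp
    moreover have "?x s \<noteq> 0" using s(1) \<kappa>(2) r e(1) by simp
    moreover have "v (?x s) = m + v (e (r + s))"
      using s(1) \<kappa>(2,3)[OF _ r(1,2)] r(3) e(1) by (simp add: v_mult m_def)
    \<comment> \<open>The window bound \<open>v (e (r + s)) < h + q\<close> keeps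
      \<open>?x s\<close> out of that ideal.\<close>
    ultimately show False using e(4)[of "r + s"] by (simp add: Pideal_def)
  qed
qed

section \<open>From freeness to the equality of \<open>w\<close> and \<open>d\<close>\<close>

lemma clear_denominators:
  assumes "\<And>s. s < q \<Longrightarrow> c s \<in> K"
  obtains z where "z \<in> \<OO>" "z \<noteq> 0" "\<And>s. s < q \<Longrightarrow> z * c s \<in> \<OO>"
proof
  \<comment> \<open>The sum bounds every denominator at once; as \<open>v \<pi> = q\<close> is at
    least 1, the power \<open>N\<close> of \<open>\<pi>\<close> suffices.\<close>
  define N where "N = (\<Sum>s<q. \<bar>v (c s)\<bar>)"
  have N: "0 \<le> N" unfolding N_def by (simp add: sum_nonneg)
  have "1 \<le> int q" using q_pos by linarith
  from mult_left_mono[OF this N] have qN: "N \<le> N * int q" by simp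
  show "\<pi> powi N \<in> \<OO>" using pi_powi[of N] N by (simp add: valring_def)
  show "\<pi> powi N \<noteq> 0" by (rule pi_powi)
  fix s assume s: "s < q"
  have "\<bar>v (c s)\<bar> \<le> N" unfolding N_def using s by (intro member_le_sum) auto
  then have "0 \<le> N * int q + v (c s)" using qN by linarith
  then show "\<pi> powi N * c s \<in> \<OO>"
    using pi_powi[of N] assms[OF s] L.K_closed by (cases "c s = 0") (auto simp: valring_def v_mult)
qed

lemma emb_in_order: "z \<in> \<OO> \<Longrightarrow> emb z \<in> \<AA>"
  using valring_K valring_mult_P by (auto simp: assoc_order_def act_emb)

text \<open>For a basis element \<open>\<rho>\<close>, the \<open>\<Phi> s\<close> applied to it are
  \<open>q\<close> independent vectors and so span the field over \<open>K\<close>. A second basis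
  element would be a \<open>K\<close>-combination of them, which after clearing denominators is a
  forbidden relation over \<open>\<AA>\<close>.\<close>

lemma free_imp_cyclic:
  assumes Phi: "\<And>s. s < q \<Longrightarrow> \<Phi> s \<in> \<AA>" and free: "free_module \<AA> act (\<PP> h)"
  obtains \<rho> where "\<rho> \<in> \<PP> h" "\<And>y. y \<in> \<PP> h \<Longrightarrow> \<exists>\<alpha>\<in>\<AA>. y = act \<alpha> \<rho>"
proof -
  obtain E where E3: "E \<subseteq> \<PP> h \<and>
    (\<forall>y\<in>\<PP> h. \<exists>c. finite {e\<in>E. c e \<noteq> 0} \<and> (\<forall>e\<in>E. c e \<in> \<AA>) \<and>
      y = (\<Sum>e\<in>{e\<in>E. c e \<noteq> 0}. act (c e) e)) \<and>
    (\<forall>c. finite {e\<in>E. c e \<noteq> 0} \<and> (\<forall>e\<in>E. c e \<in> \<AA>) \<and>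
      (\<Sum>e\<in>{e\<in>E. c e \<noteq> 0}. act (c e) e) = 0 \<longrightarrow> (\<forall>e\<in>E. c e = 0))"
    using free unfolding free_module_def ..
  note E = E3[THEN conjunct1]
    and span = E3[THEN conjunct2, THEN conjunct1]
    and indep = E3[THEN conjunct2, THEN conjunct2]
  have zero: "0 \<in> \<AA>" using P_zero by (simp add: assoc_order_def act_zero_left)
  have two: "\<alpha> = 0 \<and> \<beta> = 0"
    if "f \<in> E" "f' \<in> E" "f \<noteq> f'" "\<alpha> \<in> \<AA>" "\<beta> \<in> \<AA>" "act \<alpha> f + act \<beta> f' = 0" for f f' \<alpha> \<beta>
  proof -
    define c where "c = (\<lambda>_. 0)(f := \<alpha>, f' := \<beta>)"
    have sub: "{e\<in>E. c e \<noteq> 0} \<subseteq> {f, f'}" by (auto simp: c_def)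
    then have fin: "finite {e\<in>E. c e \<noteq> 0}" by (rule finite_subset) simp
    have "(\<Sum>e\<in>{e\<in>E. c e \<noteq> 0}. act (c e) e) = (\<Sum>e\<in>{f, f'}. act (c e) e)"
      using sub that(1,2) by (intro sum.mono_neutral_left) (auto simp: act_zero_left)
    also have "\<dots> = 0" using that(3,6) by (simp add: c_def)
    finally have "(\<Sum>e\<in>{e\<in>E. c e \<noteq> 0}. act (c e) e) = 0" .
    moreover have "\<forall>e\<in>E. c e \<in> \<AA>" using that(4,5) zero by (simp add: c_def)
    ultimately have "\<forall>e\<in>E. c e = 0" using fin indep by blast
    then show ?thesis using that(1-3) by (auto simp: c_def)
  qed
  have one: "\<alpha> = 0" if "f \<in> E" "\<alpha> \<in> \<AA>" "act \<alpha> f = 0" for f \<alpha>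
  proof -
    define c where "c = (\<lambda>_. 0)(f := \<alpha>)"
    have sub: "{e\<in>E. c e \<noteq> 0} \<subseteq> {f}" by (auto simp: c_def)
    then have fin: "finite {e\<in>E. c e \<noteq> 0}" by (rule finite_subset) simp
    have "(\<Sum>e\<in>{e\<in>E. c e \<noteq> 0}. act (c e) e) = (\<Sum>e\<in>{f}. act (c e) e)"
      using sub that(1) by (intro sum.mono_neutral_left) (auto simp: act_zero_left)
    also have "\<dots> = 0" using that(3) by (simp add: c_def)
    finally have "(\<Sum>e\<in>{e\<in>E. c e \<noteq> 0}. act (c e) e) = 0" .
    moreover have "\<forall>e\<in>E. c e \<in> \<AA>" using that(2) zero by (simp add: c_def)
    ultimately have "\<forall>e\<in>E. c e = 0" using fin indep by blast
    then show ?thesis using that(1) by (auto simp: c_def)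
  qed
  have "E \<noteq> {}"
  proof
    assume "E = {}"
    then have "lam h = 0" using span P_self[of "lam h"] lam by fastforce
    then show False using lam by simp
  qed
  then obtain \<rho> where \<rho>: "\<rho> \<in> E" by blast
  have indep_\<rho>: "\<forall>s<q. c s = 0"
    if c: "\<forall>s<q. c s \<in> K" and rel: "(\<Sum>s<q. c s * act (\<Phi> s) \<rho>) = 0" for c
  proof -
    \<comment> \<open>Multiplication by \<open>z\<close> moves the operator into
      \<open>\<AA>\<close>, where freeness forces it to vanish.\<close>
    obtain z where z: "z \<in> \<OO>" "z \<noteq> 0" "\<And>s. s < q \<Longrightarrow> z * c s \<in> \<OO>"
      using clear_denominators c by blast
    have zK: "\<forall>s<q. z * c s \<in> K" using z(3) valring_K by blast
    have "act (\<Sum>s<q. emb (z * c s) * \<Phi> s) \<rho> = z * (\<Sum>s<q. c s * act (\<Phi> s) \<rho>)"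
      using zK by (subst act_combination) (auto simp: sum_distrib_left mult.assoc)
    moreover have "(\<Sum>s<q. emb (z * c s) * \<Phi> s) \<in> \<AA>" using Phi z(3) by (intro order_combination) auto
    ultimately have "(\<Sum>s<q. emb (z * c s) * \<Phi> s) = 0" using rel by (intro one[OF \<rho>]) auto
    from Phi_independent[OF zK this] show ?thesis using z(2) by simp
  qed
  have "f = \<rho>" if f: "f \<in> E" for f
  proof (rule ccontr)
    assume ne: "f \<noteq> \<rho>"
    obtain B where "module_basis K (*) UNIV B {..<q}" using deg_L by blast
    then have "module_basis K (*) UNIV (\<lambda>s. act (\<Phi> s) \<rho>) {..<q}"
      by (rule L.independent_imp_basis) (rule indep_\<rho>)
    then obtain c where c: "\<forall>s\<in>{..<q}. c s \<in> K" "f = (\<Sum>s<q. c s * act (\<Phi> s) \<rho>)"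
      unfolding module_basis_def by blast
    then obtain z where z: "z \<in> \<OO>" "z \<noteq> 0" "\<And>s. s < q \<Longrightarrow> z * c s \<in> \<OO>"
      using clear_denominators by blast
    have zK: "\<forall>s<q. z * c s \<in> K" using z(3) valring_K by blast
    have mz: "- z \<in> \<OO>" using z(1) P_uminus L.K_closed by (simp add: valring_P)
    have "act (\<Sum>s<q. emb (z * c s) * \<Phi> s) \<rho> = z * f"
      unfolding c(2) using zK by (subst act_combination) (auto simp: sum_distrib_left mult.assoc)
    moreover have "act (emb (- z)) f = - (z * f)" using act_emb[OF valring_K[OF mz]] by simp
    ultimately have "act (\<Sum>s<q. emb (z * c s) * \<Phi> s) \<rho> + act (emb (- z)) f = 0" by simp
    moreover have "(\<Sum>s<q. emb (z * c s) * \<Phi> s) \<in> \<AA>" using Phi z(3) by (intro order_combination) auto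
    ultimately have "emb (- z) = 0" using two[OF \<rho> f ne[symmetric] _ emb_in_order[OF mz]] by blast
    then show False using emb_eq_0[OF valring_K[OF mz]] z(2) by simp
  qed
  then have E_eq: "E = {\<rho>}" using \<rho> by blast
  show thesis
  proof
    show "\<rho> \<in> \<PP> h" using E \<rho> by blast
    fix y assume "y \<in> \<PP> h"
    then obtain c where c: "c \<rho> \<in> \<AA>" "y = (\<Sum>e\<in>{e\<in>{\<rho>}. c e \<noteq> 0}. act (c e) e)"
      using span unfolding E_eq by blast
    have "y = act (c \<rho>) \<rho>"
    proof (cases "c \<rho> = 0")
      case False
      then have "{e\<in>{\<rho>}. c e \<noteq> 0} = {\<rho>}" by auto
      then show ?thesis using c(2) by simp
    qed (use c(2) act_zero_left in auto)
    then show "\<exists>\<alpha>\<in>\<AA>. y = act \<alpha> \<rho>" using c(1) by blast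
  qed
qed

lemma free_imp_wfun_eq_dfun:
  assumes T: "int q + b - h \<le> int T" and free: "free_module \<AA> act (\<PP> h)" and k: "k < q"
  shows "w k = d k"
proof -
  have "b - h \<le> int T" using T q_pos by linarith
  then have Phi: "\<Phi> s \<in> \<AA>" if "s < q" for s using that by (rule Phi_in_order)
  obtain \<rho> where \<rho>: "\<rho> \<in> \<PP> h" "\<And>y. y \<in> \<PP> h \<Longrightarrow> \<exists>\<alpha>\<in>\<AA>. y = act \<alpha> \<rho>"
    using free_imp_cyclic[OF Phi free] by blast
  obtain x where x: "\<And>r. r < q \<Longrightarrow> x r \<in> \<OO>" "\<rho> = (\<Sum>r<q. x r * e r)"
    using e_expansion[OF \<rho>(1)] by blast
  \<comment> \<open>Row \<open>s\<close> holds the coordinates of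
    \<open>act (\<Phi> s) \<rho>\<close> in the basis \<open>e\<close>, up to error; the column is
    \<open>u = r + s\<close>, which gives zeros left of the diagonal.\<close>
  define M where "M = (\<lambda>s u. if s \<le> u then x (u - s) * \<kappa> s (u - s) else 0)"
  have M_integral: "M s u \<in> \<OO>" if "s < q" "u < q" for s u
    unfolding M_def using that x(1) \<kappa>_valring valring_closed by simp
  have Phi_\<rho>: "act (\<Phi> s) \<rho> - (\<Sum>u<q. M s u * e u) \<in> \<PP> (h + int q)" if s: "s < q" for s
  proof -
    have "(\<Sum>u<q. M s u * e u) = (\<Sum>u\<in>{s..<q}. M s u * e u)"
      by (rule sum.mono_neutral_right) (auto simp: M_def)
    \<comment> \<open>Substituting \<open>u = r + s\<close>; the range is then completed to all
      \<open>r < q\<close>, since \<open>r + s \<ge> q\<close> forces a carry and a zero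
      coefficient.\<close>
    also have "\<dots> = (\<Sum>r\<in>{..<q - s}. x r * \<kappa> s r * e (r + s))"
      using s by (intro sum.reindex_bij_witness[of _ "\<lambda>r. r + s" "\<lambda>u. u - s"]) (auto simp: M_def)
    also have "\<dots> = (\<Sum>r<q. x r * \<kappa> s r * e (r + s))"
    proof (rule sum.mono_neutral_left)
      show "\<forall>r\<in>{..<q} - {..<q - s}. x r * \<kappa> s r * e (r + s) = 0"
      proof
        fix r assume r: "r \<in> {..<q} - {..<q - s}"
        then have "\<not> no_carry p n s r" using digit_add(1)[OF s, of r] by auto
        then show "x r * \<kappa> s r * e (r + s) = 0" using \<kappa>(4)[OF s] r by simp
      qed
    qed auto
    finally have M_eq: "(\<Sum>u<q. M s u * e u) = (\<Sum>r<q. x r * \<kappa> s r * e (r + s))" .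
    have "act (\<Phi> s) \<rho> = (\<Sum>r<q. x r * act (\<Phi> s) (e r))"
      unfolding x(2) act_sum_right using x(1) valring_K by (intro sum.cong) (auto simp: act_scale)
    then have "act (\<Phi> s) \<rho> - (\<Sum>u<q. M s u * e u) = (\<Sum>r<q. x r * (act (\<Phi> s) (e r) - \<kappa> s r * e (r + s)))"
      unfolding M_eq by (simp add: sum_subtractf right_diff_distrib mult.assoc)
    also have "\<dots> \<in> \<PP> (h + int q)"
    proof (intro P_sum valring_mult_P)
      fix r assume "r \<in> {..<q}"
      then have r: "r < q" by simp
      show "x r \<in> \<OO>" by (rule x(1)[OF r])
      show "act (\<Phi> s) (e r) - \<kappa> s r * e (r + s) \<in> \<PP> (h + int q)"
        using \<kappa>(5)[OF s r] by (rule P_mono) (use T in linarith)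
    qed
    finally show ?thesis .
  qed
  have "M k k \<notin> \<PP> 1"
  proof (rule triangular_spanning_diagonal_unit[where M = M, OF _ _ _ k])
    show "M s u \<in> \<PP> 0" if "s < q" "u < q" for s u using M_integral[OF that] by (simp add: valring_P)
    show "M s u = 0" if "u < s" for s u using that by (simp add: M_def)
  next
    fix k assume k: "k < q"
    obtain \<alpha> where \<alpha>: "\<alpha> \<in> \<AA>" "e k = act \<alpha> \<rho>" using \<rho>(2)[OF e_in_P] by blast
    obtain c where c: "\<forall>s\<in>{..<q}. c s \<in> \<OO>" "\<alpha> = (\<Sum>s<q. emb (c s) * \<Phi> s)"
      using order_basis_strong[OF T] \<alpha>(1) unfolding module_basis_def by blast
    \<comment> \<open>The row combination that approximates \<open>e k\<close>; the errors lie in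
      \<open>\<PP> (h + q)\<close>, so it will agree with unit vector \<open>k\<close> modulo the
      maximal ideal.\<close>
    define N where "N = (\<lambda>u. \<Sum>s<q. c s * M s u)"
    have N: "N u \<in> K" if "u < q" for u
      unfolding N_def using c(1) M_integral that valring_K L.K_closed
      by (intro subfield_sum[OF K_sub]) auto
    have "e k = (\<Sum>s<q. c s * act (\<Phi> s) \<rho>)"
      unfolding \<alpha>(2) c(2) using c(1) valring_K by (intro act_combination) auto
    moreover have "(\<Sum>u<q. N u * e u) = (\<Sum>s<q. c s * (\<Sum>u<q. M s u * e u))"
      unfolding N_def sum_distrib_left sum_distrib_right by (subst sum.swap) (simp add: mult.assoc)
    ultimately have "e k - (\<Sum>u<q. N u * e u) = (\<Sum>s<q. c s * (act (\<Phi> s) \<rho> - (\<Sum>u<q. M s u * e u)))"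
      by (simp add: sum_subtractf right_diff_distrib)
    also have "\<dots> \<in> \<PP> (h + int q)" using c(1) Phi_\<rho> by (intro P_sum valring_mult_P) auto
    also have "e k - (\<Sum>u<q. N u * e u) = (\<Sum>u<q. ((if u = k then 1 else 0) - N u) * e u)"
      using k by (simp add: left_diff_distrib sum_subtractf if_distrib[of "\<lambda>x. x * _"] cong: if_cong)
    finally have "(\<Sum>u<q. ((if u = k then 1 else 0) - N u) * e u) \<in> \<PP> (h + int q)" .
    then have "((if u = k then 1 else 0) - N u) * e u \<in> \<PP> (h + int q)" if "u < q" for u
      using N L.K_closed that by (intro distinct_mod_terms[OF distinct_mod_e]) auto
    \<comment> \<open>\<open>e u\<close> has valuation below \<open>h + q\<close>, so cancelling it
      leaves a coefficient in \<open>\<PP> 1\<close>.\<close>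
    then have "(if u = k then 1 else 0) - N u \<in> \<PP> 1" if "u < q" for u
      using that e(1,4)[of u] by (intro P_cancel[of _ "e u" "h + int q"]) auto
    then show "\<exists>c. (\<forall>s<q. c s \<in> \<PP> 0) \<and> (\<forall>u<q. (if u = k then 1 else 0) - (\<Sum>s<q. c s * M s u) \<in> \<PP> 1)"
      using c(1) unfolding N_def by (intro exI[of _ c]) (auto simp: valring_P)
  qed
  \<comment> \<open>Diagonal entries belong to \<open>r = 0\<close>, where
    \<open>\<kappa> k 0\<close> has valuation \<open>q * (d k - w k)\<close> as
    \<open>d 0 = 0\<close>. Being outside the maximal ideal gives \<open>d k \<le> w k\<close>; the
    other inequality is general.\<close>
  then have "x 0 * \<kappa> k 0 \<notin> \<PP> 1" by (simp add: M_def)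
  then have "\<kappa> k 0 \<notin> \<PP> 1" using valring_mult_P[OF x(1)[OF q_pos]] by blast
  then have "int q * (d k - w k) < 1"
    using \<kappa>(3)[OF k q_pos no_carry_0] dfun_0 by (simp add: Pideal_def)
  moreover have "int q * 1 \<le> int q * (d k - w k)" if "1 \<le> d k - w k"
    using that by (intro mult_left_mono) auto
  ultimately have "\<not> 1 \<le> d k - w k" using q_pos by linarith
  then show ?thesis using wfun_le_dfun[OF k] by linarith
qed

end

theorem theorem3p1:
  fixes K :: "'l::field set" and v :: "'l \<Rightarrow> int"
    and emb :: "'l \<Rightarrow> 'a::ring_1" and act :: "'a \<Rightarrow> 'l \<Rightarrow> 'l"
    and p n :: nat and bs :: "nat \<Rightarrow> int" and T :: enat
    and lam :: "int \<Rightarrow> 'l" and Psi :: "nat \<Rightarrow> 'a" and \<pi> :: 'l and h :: int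
  assumes prime_p: "prime p"
    and K_sub: "subfield K"
    and v_disc: "discrete_valuation v"
    and K_norm: "{v x | x. x \<in> K \<and> x \<noteq> 0} = {int (p ^ n) * k | k. True}"
    and K_complete: "complete_wrt K v"
    and res_char: "of_nat p \<in> K \<and> (of_nat p = (0::'l) \<or> 0 < v (of_nat p))"
    and deg_L: "\<exists>B. module_basis K (*) UNIV B {..<p ^ n}"
    and A_alg: "K_algebra_acting K emb act"
    and deg_A: "\<exists>B. module_basis K (\<lambda>k \<alpha>. emb k * \<alpha>) UNIV B {..<p ^ n}"
    and bs_coprime: "\<forall>i\<in>{1..n}. coprime (bs i) (int p)"
    and scaf: "scaffold K v act p n bs T lam Psi"
    and unif: "\<pi> \<in> K \<and> \<pi> \<noteq> 0 \<and> v \<pi> = int (p ^ n)"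
  shows
    "(enat (nat (int (p ^ n) + bpt p n bs h - h)) \<le> T \<longrightarrow>
        module_basis (valring K v) (\<lambda>k \<alpha>. emb k * \<alpha>) (assoc_order v act h)
           (Phi emb \<pi> p n bs h Psi) {..<p ^ n}
      \<and> (free_module (assoc_order v act h) act (Pideal v h) \<longleftrightarrow>
           (\<forall>s<p ^ n. wfun p n bs h s = dfun p n bs h s))
      \<and> ((\<forall>s<p ^ n. wfun p n bs h s = dfun p n bs h s) \<longrightarrow>
           (\<forall>\<rho>. \<rho> \<noteq> 0 \<and> v \<rho> = bpt p n bs h \<longrightarrow>
              (\<lambda>\<alpha>. act \<alpha> \<rho>) ` assoc_order v act h = Pideal v h)))
   \<and> (enat (nat (max (bpt p n bs h - h) 1)) \<le> T \<longrightarrow>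
        (\<forall>s<p ^ n. Phi emb \<pi> p n bs h Psi s \<in> assoc_order v act h)
      \<and> ((\<forall>s<p ^ n. wfun p n bs h s = dfun p n bs h s) \<longrightarrow>
           module_basis (valring K v) (\<lambda>k \<alpha>. emb k * \<alpha>) (assoc_order v act h)
              (Phi emb \<pi> p n bs h Psi) {..<p ^ n}
         \<and> free_module (assoc_order v act h) act (Pideal v h)
         \<and> (\<lambda>\<alpha>. act \<alpha> (lam (bpt p n bs h))) ` assoc_order v act h = Pideal v h))"
proof -
  interpret shift_parameters p n bs h using prime_p bs_coprime by unfold_locales auto
  \<comment> \<open>A scaffold also has every smaller tolerance that is at least 1, even if
    \<open>T\<close> is infinite: a zero error meets every bound.\<close>
  have weaken: "scaffolded_extension p n bs v K emb act T' lam Psi \<pi>"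
    if "enat T' \<le> T" "1 \<le> T'" for T'
  proof unfold_locales
    show "0 < p ^ n" by (rule q_pos)
    have "within_tol v (enat T') x m" if "within_tol v T x m" for x m
      using that \<open>enat T' \<le> T\<close> by (cases T) (auto simp: within_tol_def)
    moreover have "1 \<le> enat T'" using that by (simp add: one_enat_def)
    ultimately show "scaffold K v act p n bs (enat T') lam Psi"
      using scaf unfolding scaffold_def by meson
  qed (use assms in auto)
  have bh: "h \<le> b" by (rule bpt)
  show ?thesis
  proof (intro conjI impI)
    assume T: "enat (nat (int q + b - h)) \<le> T"
    have pos: "0 < int q + b - h" using bh q_pos by linarith
    \<comment> \<open>The tolerance is lowered exactly to the strong threshold, which is positive
      because \<open>h \<le> b\<close>.\<close>
    interpret scaffolded_extension p n bs h v K emb act "nat (int q + b - h)" lam Psi \<pi>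
      using T pos by (intro weaken) auto
    have T': "int q + b - h \<le> int (nat (int q + b - h))" by simp
    have "b - h \<le> int (nat (int q + b - h))" using T' q_pos by linarith
    then have Phi: "\<Phi> s \<in> \<AA>" if "s < q" for s using that by (rule Phi_in_order)
    show "module_basis \<OO> (\<lambda>k \<alpha>. emb k * \<alpha>) \<AA> \<Phi> {..<q}" by (rule order_basis_strong[OF T'])
    show "free_module \<AA> act (Pideal v h) \<longleftrightarrow> (\<forall>s<q. w s = d s)"
      using free_imp_wfun_eq_dfun[OF T'] free_of_wfun_eq_dfun(3)[OF Phi, of "lam b"] lam by blast
    show "\<forall>\<rho>. \<rho> \<noteq> 0 \<and> v \<rho> = b \<longrightarrow> (\<lambda>\<alpha>. act \<alpha> \<rho>) ` \<AA> = Pideal v h" if "\<forall>s<q. w s = d s"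
      using free_of_wfun_eq_dfun(2)[OF Phi that] by blast
  next
    assume T: "enat (nat (max (b - h) 1)) \<le> T"
    \<comment> \<open>The maximum with 1 keeps the lowered tolerance admissible when
      \<open>b = h\<close>.\<close>
    interpret scaffolded_extension p n bs h v K emb act "nat (max (b - h) 1)" lam Psi \<pi>
      using T by (intro weaken) auto
    have Phi: "\<Phi> s \<in> \<AA>" if "s < q" for s using that by (intro Phi_in_order) auto
    then show "\<forall>s<q. \<Phi> s \<in> \<AA>" by blast
    assume wd: "\<forall>s<q. w s = d s"
    show "module_basis \<OO> (\<lambda>k \<alpha>. emb k * \<alpha>) \<AA> \<Phi> {..<q}" "free_module \<AA> act (Pideal v h)"
      "(\<lambda>\<alpha>. act \<alpha> (lam b)) ` \<AA> = Pideal v h"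
      using free_of_wfun_eq_dfun[OF Phi wd] lam by blast+
  qed
qed

end
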